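(* For $c>0$ define \[ F(c)=\inf_{t\in\mathbb{N}} \frac{(t!)^{1/t}\,15^{\,c/t}}{c}. \] Then for every $k\times k$ permutation matrix $P$ with $k\ge 2$ one has \[ s_P \leq F(c_P)\,c_P^2. \] Moreover $F(c)=\log 15+o(1)$ as $c\to\infty$ (where $\log$ is the natural logarithm).
   Context: An $n\times n$ $0$-$1$ matrix $A$ contains a $k\times k$ permutation matrix $P$ if there are row indices $r_1<\cdots<r_k$ and column indices $c_1<\cdots<c_k$ such that $A_{r_i,c_j}=1$ whenever $P_{i,j}=1$; otherwise $A$ avoids $P$. Let $S_P(n)$ be the number of $n\times n$ permutation matrices avoiding $P$, and let $s_P=\lim_{n\to\infty} S_P(n)^{1/n}$ (the Stanley–Wilf limit). For a $0$-$1$ matrix $A$, $|A|$ denotes its number of ones. Let $\mathrm{ex}(n,P)=\max\{|A|: A\in\{0,1\}^{n\times n}\text{ avoids }P\}$ and $c_P=\lim_{n\to\infty}\mathrm{ex}(n,P)/n$ (the Füredi–Hajnal limit). $\mathbb{N}=\{1,2,3,\dots\}$. *)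

theory Defs
  imports "Jordan_Normal_Form.Matrix" "HOL-Library.Landau_Symbols"
begin

text \<open>Matrices are 0-indexed: an n x n matrix has row and column indices in {..<n}.\<close>

definition zero_one_matrix :: "nat \<Rightarrow> nat mat \<Rightarrow> bool" where
  "zero_one_matrix n A \<longleftrightarrow>
     A \<in> carrier_mat n n \<and> (\<forall>i<n. \<forall>j<n. A $$ (i, j) \<in> {0, 1})"

definition permutation_matrix :: "nat \<Rightarrow> nat mat \<Rightarrow> bool" where
  "permutation_matrix n A \<longleftrightarrow> zero_one_matrix n A
     \<and> (\<forall>i<n. \<exists>!j. j < n \<and> A $$ (i, j) = 1)
     \<and> (\<forall>j<n. \<exists>!i. i < n \<and> A $$ (i, j) = 1)"

definition contains_matrix :: "nat mat \<Rightarrow> nat mat \<Rightarrow> bool" where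
  "contains_matrix A P \<longleftrightarrow> (\<exists>r c :: nat \<Rightarrow> nat.
     strict_mono_on {..<dim_row P} r \<and> r ` {..<dim_row P} \<subseteq> {..<dim_row A} \<and>
     strict_mono_on {..<dim_col P} c \<and> c ` {..<dim_col P} \<subseteq> {..<dim_col A} \<and>
     (\<forall>i<dim_row P. \<forall>j<dim_col P. P $$ (i, j) = 1 \<longrightarrow> A $$ (r i, c j) = 1))"

abbreviation avoids_matrix :: "nat mat \<Rightarrow> nat mat \<Rightarrow> bool" where
  "avoids_matrix A P \<equiv> \<not> contains_matrix A P"

definition num_avoiding :: "nat mat \<Rightarrow> nat \<Rightarrow> nat" where
  "num_avoiding P n = card {A. permutation_matrix n A \<and> avoids_matrix A P}"

definition stanley_wilf_limit :: "nat mat \<Rightarrow> real" where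
  "stanley_wilf_limit P = lim (\<lambda>n. real (num_avoiding P n) powr (1 / real n))"

definition num_ones :: "nat mat \<Rightarrow> nat" where
  "num_ones A = card {(i, j). i < dim_row A \<and> j < dim_col A \<and> A $$ (i, j) = 1}"

definition extremal_number :: "nat \<Rightarrow> nat mat \<Rightarrow> nat" where
  "extremal_number n P = Max {num_ones A | A. zero_one_matrix n A \<and> avoids_matrix A P}"

definition fueredi_hajnal_limit :: "nat mat \<Rightarrow> real" where
  "fueredi_hajnal_limit P = lim (\<lambda>n. real (extremal_number n P) / real n)"

definition F :: "real \<Rightarrow> real" where
  "F c = (INF t\<in>{1::nat..}. fact t powr (1 / real t) * 15 powr (c / real t) / c)"

end

theory Submission
  imports Defs "HOL-Combinatorics.Multiset_Permutations" "HOL-Analysis.Convex" "HOL-Real_Asymp.Real_Asymp"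
begin

text \<open>Contracting a P-avoiding permutation matrix of size tn into t x t blocks gives a P-avoiding
  n x n matrix B. There are at most 15^(c n) such B up to a constant factor when n is a power of 2
  (iterated contraction into 2 x 2 blocks, each nonzero block having 15 possible contents). Given B,
  the block column of each of the tn rows can be chosen in at most c^(tn) ways in total, by the
  inequality of arithmetic and geometric means applied to the row sums of B, whose total is at most
  c n; the order inside the block columns contributes (t!)^n. Taking (tn)-th roots bounds the
  Stanley--Wilf limit by c (t!)^(1/t) 15^(c/t) for every t.

  Both limits exist by Fekete's lemma: direct or skew sums give superadditivity, the Marcus--Tardos
  argument bounds the extremal number linearly, and the count above, with t = 1, bounds the
  number of avoiding permutations exponentially.

  For the asymptotics, t! lies between (t/e)^t and e t (t/e)^t; with x = c ln 15 / t the terms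
  defining F are at least (ln 15) e^(x-1) / x, and this is minimal at x = 1, that is t near
  c ln 15.\<close>

section \<open>Superadditive sequences\<close>

lemma superadditive_mult:
  fixes u :: "nat \<Rightarrow> real"
  assumes super: "\<And>m n. u m + u n \<le> u (m + n)" and nonneg: "\<And>n. 0 \<le> u n"
  shows "real q * u n \<le> u (q * n)"
proof (induction q)
  case (Suc q)
  have "u n + real q * u n \<le> u n + u (q * n)" using Suc by simp
  also have "\<dots> \<le> u (Suc q * n)" using super[of n "q * n"] by simp
  finally show ?case by (simp add: algebra_simps)
qed (simp add: nonneg)

lemma superadditive_mono:
  fixes u :: "nat \<Rightarrow> real"
  assumes super: "\<And>m n. u m + u n \<le> u (m + n)" and nonneg: "\<And>n. 0 \<le> u n"
    and "m \<le> n"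
  shows "u m \<le> u n"
  using super[of m "n - m"] nonneg[of "n - m"] \<open>m \<le> n\<close> by simp

text \<open>Contraction recurrences control a sequence only along the powers of one base
  \<open>b\<close>. Superadditivity and nonnegativity make \<open>u\<close> nondecreasing and let
  \<open>q\<close> copies of \<open>n\<close> be packed into a large power of \<open>b\<close>; the
  packing covers at least half of it, whence the factor 2.\<close>

lemma superadditive_linear_bound:
  fixes u :: "nat \<Rightarrow> real"
  assumes super: "\<And>m n. u m + u n \<le> u (m + n)" and nonneg: "\<And>n. 0 \<le> u n"
    and b: "2 \<le> (b::nat)" and bound: "\<And>m. u (b ^ m) \<le> E * real (b ^ m)"
  shows "u n \<le> 2 * E * real n"
proof (cases "n = 0")
  case True
  then show ?thesis using super[of 0 0] by simp
next
  case False
  \<comment> \<open>The exponent \<open>n\<close> merely ensures \<open>n \<le> b ^ n\<close>, so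
    that at least one copy fits and \<open>(q + 1) * n \<le> 2 * q * n\<close>.\<close>
  define q where "q = b ^ n div n"
  have E: "0 \<le> E" using bound[of 0] nonneg[of 1] by simp
  have "n < b ^ n" using b less_exp[of n] power_mono[of 2 b n] by linarith
  then have q1: "1 \<le> q" using False by (simp add: q_def div_greater_zero_iff Suc_le_eq)
  have qn: "q * n \<le> b ^ n" by (simp add: q_def)
  have "b ^ n < (q + 1) * n"
    using False dividend_less_div_times[of n "b ^ n"] by (simp add: q_def)
  also have "\<dots> \<le> 2 * q * n" using q1 by simp
  finally have bn: "real (b ^ n) \<le> 2 * real q * real n"
    by (metis less_imp_le of_nat_le_iff of_nat_mult of_nat_numeral)
  have "real q * u n \<le> u (q * n)" by (rule superadditive_mult[where u = u, OF super nonneg])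
  also have "\<dots> \<le> u (b ^ n)" by (rule superadditive_mono[where u = u, OF super nonneg qn])
  also have "\<dots> \<le> E * real (b ^ n)" by (rule bound)
  also have "\<dots> \<le> E * (2 * real q * real n)" by (rule mult_left_mono[OF bn E])
  finally have "real q * u n \<le> real q * (2 * E * real n)" by (simp add: algebra_simps)
  then show ?thesis using q1 by simp
qed

text \<open>The limit is the supremum of \<open>u n / n\<close>, so it dominates every single term.
  The second conclusion records this; it turns the limit of the extremal numbers into a bound valid
  for each \<open>n\<close>.\<close>

lemma fekete_superadditive:
  fixes u :: "nat \<Rightarrow> real"
  assumes super: "\<And>m n. u m + u n \<le> u (m + n)" and nonneg: "\<And>n. 0 \<le> u n"
    and bound: "\<And>n. u n \<le> C * real n"
  obtains L where "(\<lambda>n. u n / real n) \<longlonglongrightarrow> L" "\<And>n. u n \<le> L * real n"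
proof -
  define L where "L = (SUP n\<in>{1..}. u n / real n)"
  have bdd: "bdd_above ((\<lambda>n. u n / real n) ` {1..})"
    by (rule bdd_aboveI[of _ C]) (use bound in \<open>auto simp: field_simps\<close>)
  have le: "u n / real n \<le> L" if "1 \<le> n" for n
    unfolding L_def by (rule cSUP_upper[OF _ bdd]) (use that in auto)
  have le': "u n \<le> L * real n" for n
  proof (cases "n = 0")
    case True
    then show ?thesis using super[of 0 0] by simp
  next
    case False
    then show ?thesis using le[of n] by (simp add: field_simps)
  qed
  have "(\<lambda>n. u n / real n) \<longlonglongrightarrow> L"
  proof (rule order_tendstoI)
    fix a assume "L < a"
    then show "\<forall>\<^sub>F n in sequentially. u n / real n < a"
      using le by (intro eventually_sequentiallyI[of 1]) (auto intro: le_less_trans)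
  next
    fix a assume "a < L"
    then obtain m where m: "1 \<le> m" "a < u m / real m"
      unfolding L_def using less_cSUP_iff[OF _ bdd] by auto
    \<comment> \<open>The index \<open>m\<close> nearly attains the supremum. Packing
      \<open>n div m\<close> copies of \<open>m\<close> into \<open>n\<close> leaves a remainder
      below \<open>m\<close>, which vanishes after division by \<open>n\<close>.\<close>
    have lower: "u m / real m * (real n - real m) / real n \<le> u n / real n" if "1 \<le> n" for n
    proof -
      have "real n - real m \<le> real m * real (n div m)"
        using m dividend_less_div_times[of m n] of_nat_less_iff[where ?'a = real]
        by (smt (verit, ccfv_threshold) mult.commute of_nat_add of_nat_mult less_eq_Suc_le One_nat_def)
      then have "u m / real m * (real n - real m) \<le> u m / real m * (real m * real (n div m))"
        using nonneg by (intro mult_left_mono) auto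
      also have "\<dots> = real (n div m) * u m" using m by simp
      also have "\<dots> \<le> u (n div m * m)" by (rule superadditive_mult[where u = u, OF super nonneg])
      also have "\<dots> \<le> u n" by (rule superadditive_mono[where u = u, OF super nonneg]) simp
      finally show ?thesis by (rule divide_right_mono) simp
    qed
    have "(\<lambda>n. u m / real m * (real n - real m) / real n) \<longlonglongrightarrow> u m / real m"
      by real_asymp
    then have "\<forall>\<^sub>F n in sequentially. a < u m / real m * (real n - real m) / real n"
      using m(2) by (rule order_tendstoD)
    then show "\<forall>\<^sub>F n in sequentially. a < u n / real n"
      using eventually_ge_at_top[of 1] by eventually_elim (use lower in \<open>auto intro: less_le_trans\<close>)
  qed
  then show ?thesis using that le' by blast
qed

section \<open>Asymptotics of F\<close>

text \<open>One term of the exponential series at \<open>t\<close>, namely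
  \<open>t ^ t / fact t\<close>, is at most the whole sum.\<close>

lemma fact_ge_power_div_exp: "(real t / exp 1) ^ t \<le> fact t"
proof -
  have "(\<Sum>k\<in>{t}. real t ^ k /\<^sub>R fact k) \<le> (\<Sum>k. real t ^ k /\<^sub>R fact k)"
    by (rule sum_le_suminf[OF summable_exp_generic]) auto
  then have "real t ^ t / fact t \<le> exp (real t)"
    by (simp add: exp_def field_simps)
  then show ?thesis
    by (simp add: power_divide field_simps flip: exp_of_nat_mult)
qed

text \<open>In the induction step everything cancels except the classical inequality
  \<open>e \<le> ((t + 1) / t) ^ (t + 1)\<close>.\<close>

lemma fact_le_power_div_exp: "1 \<le> t \<Longrightarrow> fact t \<le> exp 1 * real t * (real t / exp 1) ^ t"
proof (induction t rule: dec_induct)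
  case (step t)
  have "exp 1 * real t ^ Suc t \<le> real (Suc t) ^ Suc t"
  proof -
    \<comment> \<open>The inequality \<open>ln x \<le> x - 1\<close> at
      \<open>x = t / (t + 1)\<close> says that \<open>ln ((t + 1) / t)\<close> is at least
      \<open>1 / (t + 1)\<close>.\<close>
    have "ln (real t / real (Suc t)) \<le> real t / real (Suc t) - 1"
      using step by (intro ln_le_minus_one) auto
    then have "1 \<le> real (Suc t) * ln (real (Suc t) / real t)"
      using step by (simp add: ln_div field_simps)
    then have "exp 1 \<le> exp (real (Suc t) * ln (real (Suc t) / real t))"
      by simp
    also have "\<dots> = (real (Suc t) / real t) ^ Suc t"
      using step by (subst exp_of_nat_mult) (simp add: field_simps)
    finally show ?thesis using step by (simp add: power_divide field_simps)
  qed
  then have key: "real t * real t ^ t \<le> real (Suc t) ^ Suc t / exp 1"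
    by (simp add: field_simps)
  have "fact (Suc t) \<le> real (Suc t) * (exp 1 * real t * (real t / exp 1) ^ t)"
    using step.IH by simp
  also have "\<dots> = real (Suc t) * exp 1 / exp 1 ^ t * (real t * real t ^ t)"
    by (simp add: power_divide)
  also have "\<dots> \<le> real (Suc t) * exp 1 / exp 1 ^ t * (real (Suc t) ^ Suc t / exp 1)"
    by (rule mult_left_mono[OF key]) simp
  also have "\<dots> = exp 1 * real (Suc t) * (real (Suc t) / exp 1) ^ Suc t"
    by (simp add: power_divide)
  finally show ?case .
qed simp

text \<open>After the lower Stirling bound, only \<open>x \<le> exp (x - 1)\<close> is needed, with
  equality at \<open>x = 1\<close>. The estimate serves twice: as the lower bound for
  \<open>F\<close>, and to show that the infimum defining \<open>F\<close> is taken over a set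
  bounded below.\<close>

lemma F_term_ge:
  assumes "0 < c" "1 \<le> (t::nat)"
  shows "ln 15 \<le> fact t powr (1 / real t) * 15 powr (c / real t) / c"
proof -
  define x where "x = c * ln 15 / real t"
  have x: "0 < x" using assms by (simp add: x_def)
  have "ln 15 * c = real t * x" using assms by (simp add: x_def)
  also have "\<dots> \<le> real t * exp (x - 1)"
    using exp_ge_add_one_self[of "x - 1"] by (intro mult_left_mono) auto
  also have "\<dots> = real t / exp 1 * exp x" by (simp add: exp_diff)
  also have "\<dots> = ((real t / exp 1) ^ t) powr (1 / real t) * 15 powr (c / real t)"
    using assms by (simp add: powr_powr powr_def x_def flip: powr_realpow)
  also have "\<dots> \<le> fact t powr (1 / real t) * 15 powr (c / real t)"
    using fact_ge_power_div_exp[of t] by (intro mult_right_mono powr_mono2) auto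
  finally show ?thesis using assms by (simp add: field_simps)
qed

lemma bdd_below_F:
  assumes "0 < c"
  shows "bdd_below ((\<lambda>t. fact t powr (1 / real t) * 15 powr (c / real t) / c) ` {1::nat..})"
  using F_term_ge[OF assms] by (auto intro!: bdd_belowI[of _ "ln 15"])

lemma F_ge_ln: "0 < c \<Longrightarrow> ln 15 \<le> F c"
  unfolding F_def by (rule cINF_greatest) (use F_term_ge in auto)

text \<open>The chosen \<open>t\<close> rounds up the optimal value \<open>c * ln 15\<close>. The
  factor \<open>(exp 1 * t) powr (1 / t)\<close> is the loss in the upper Stirling bound and tends
  to 1, while \<open>1 / c\<close> is the loss from rounding.\<close>

lemma F_le:
  assumes "0 < c"
  defines "t \<equiv> nat \<lceil>c * ln 15\<rceil>"
  shows "F c \<le> (exp 1 * real t) powr (1 / real t) * (ln 15 + 1 / c)"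
proof -
  have pos: "0 < c * ln 15" using assms by simp
  then have t1: "1 \<le> t" by (simp add: t_def Suc_le_eq)
  have t: "c * ln 15 \<le> real t" "real t \<le> c * ln 15 + 1"
    using pos by (simp_all add: t_def)
  have "F c \<le> fact t powr (1 / real t) * 15 powr (c / real t) / c"
    unfolding F_def by (rule cINF_lower[OF bdd_below_F]) (use assms t1 in auto)
  \<comment> \<open>Since \<open>c * ln 15 \<le> t\<close>, the power of 15 is at most
    \<open>exp 1\<close>; in the next step it cancels the \<open>exp 1\<close> in the denominator of
    Stirling's bound.\<close>
  also have "\<dots> \<le> (exp 1 * real t * (real t / exp 1) ^ t) powr (1 / real t) * exp 1 / c"
    using fact_le_power_div_exp[OF t1] t t1 \<open>0 < c\<close>
    by (intro divide_right_mono mult_mono powr_mono2) (auto simp: powr_def field_simps)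
  also have "\<dots> = (exp 1 * real t) powr (1 / real t) * (real t / c)"
    using t1 by (simp add: powr_mult powr_powr flip: powr_realpow)
  also have "\<dots> \<le> (exp 1 * real t) powr (1 / real t) * (ln 15 + 1 / c)"
    using t \<open>0 < c\<close> by (intro mult_left_mono) (auto simp: field_simps)
  finally show ?thesis .
qed

lemma tendsto_F: "(F \<longlongrightarrow> ln 15) at_top"
proof (rule tendsto_sandwich)
  show "\<forall>\<^sub>F c in at_top. ln 15 \<le> F c"
    using eventually_gt_at_top[of 0] by eventually_elim (rule F_ge_ln)
  show "\<forall>\<^sub>F c in at_top. F c \<le> (exp 1 * real (nat \<lceil>c * ln 15\<rceil>)) powr (1 / real (nat \<lceil>c * ln 15\<rceil>)) * (ln 15 + 1 / c)"
    using eventually_gt_at_top[of 0] by eventually_elim (rule F_le)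
  have *: "filterlim (\<lambda>c::real. nat \<lceil>c * ln 15\<rceil>) at_top at_top"
    by (rule filterlim_compose[OF filterlim_nat_sequentially]) real_asymp
  have "(\<lambda>t. (exp 1 * real t) powr (1 / real t)) \<longlonglongrightarrow> 1" by real_asymp
  from filterlim_compose[OF this *]
  have 1: "((\<lambda>c::real. (exp 1 * real (nat \<lceil>c * ln 15\<rceil>)) powr (1 / real (nat \<lceil>c * ln 15\<rceil>))) \<longlongrightarrow> 1) at_top" .
  have "((\<lambda>c::real. ln 15 + 1 / c) \<longlongrightarrow> ln 15) at_top" by real_asymp
  from tendsto_mult[OF 1 this]
  show "((\<lambda>c. (exp 1 * real (nat \<lceil>c * ln 15\<rceil>)) powr (1 / real (nat \<lceil>c * ln 15\<rceil>)) * (ln 15 + 1 / c)) \<longlongrightarrow> ln 15) at_top"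
    by simp
qed simp

section \<open>Point sets and contraction\<close>

text \<open>A 0-1 matrix is represented by the set of positions of its ones. For a permutation matrix R,
  containment amounts to a map of the ones of R into S that preserves the strict order of rows and
  that of columns, with no reference to the empty rows and columns in between.\<close>

definition embeds :: "(nat \<times> nat) set \<Rightarrow> (nat \<times> nat) set \<Rightarrow> bool" where
  "embeds R S \<longleftrightarrow> (\<exists>p. (\<forall>e\<in>R. p e \<in> S) \<and>
     (\<forall>e\<in>R. \<forall>e'\<in>R. (fst e < fst e' \<longrightarrow> fst (p e) < fst (p e')) \<and>
                   (snd e < snd e' \<longrightarrow> snd (p e) < snd (p e'))))"

definition is_perm :: "nat \<Rightarrow> (nat \<times> nat) set \<Rightarrow> bool" where
  "is_perm n R \<longleftrightarrow> bij_betw fst R {..<n} \<and> bij_betw snd R {..<n}"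

definition avoiders :: "(nat \<times> nat) set \<Rightarrow> nat \<Rightarrow> (nat \<times> nat) set set" where
  "avoiders R n = {S. S \<subseteq> {..<n} \<times> {..<n} \<and> \<not> embeds R S}"

definition perm_avoiders :: "(nat \<times> nat) set \<Rightarrow> nat \<Rightarrow> (nat \<times> nat) set set" where
  "perm_avoiders R n = {S. is_perm n S \<and> \<not> embeds R S}"

definition extremal :: "(nat \<times> nat) set \<Rightarrow> nat \<Rightarrow> nat" where
  "extremal R n = Max (card ` avoiders R n)"

definition contract :: "nat \<Rightarrow> (nat \<times> nat) set \<Rightarrow> (nat \<times> nat) set" where
  "contract b S = (\<lambda>e. (fst e div b, snd e div b)) ` S"

lemma embedsI:
  assumes "\<And>e. e \<in> R \<Longrightarrow> p e \<in> S"
    and "\<And>e e'. e \<in> R \<Longrightarrow> e' \<in> R \<Longrightarrow> fst e < fst e' \<Longrightarrow> fst (p e) < fst (p e')"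
    and "\<And>e e'. e \<in> R \<Longrightarrow> e' \<in> R \<Longrightarrow> snd e < snd e' \<Longrightarrow> snd (p e) < snd (p e')"
  shows "embeds R S"
  unfolding embeds_def using assms by blast

lemma embedsE:
  assumes "embeds R S"
  obtains p where "\<And>e. e \<in> R \<Longrightarrow> p e \<in> S"
    and "\<And>e e'. e \<in> R \<Longrightarrow> e' \<in> R \<Longrightarrow> fst e < fst e' \<Longrightarrow> fst (p e) < fst (p e')"
    and "\<And>e e'. e \<in> R \<Longrightarrow> e' \<in> R \<Longrightarrow> snd e < snd e' \<Longrightarrow> snd (p e) < snd (p e')"
  using assms unfolding embeds_def by blast

lemma embeds_converse:
  assumes "embeds R S"
  shows "embeds (R\<inverse>) (S\<inverse>)"
proof -
  from assms obtain p where p: "\<And>e. e \<in> R \<Longrightarrow> p e \<in> S"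
    "\<And>e e'. e \<in> R \<Longrightarrow> e' \<in> R \<Longrightarrow> fst e < fst e' \<Longrightarrow> fst (p e) < fst (p e')"
    "\<And>e e'. e \<in> R \<Longrightarrow> e' \<in> R \<Longrightarrow> snd e < snd e' \<Longrightarrow> snd (p e) < snd (p e')"
    by (rule embedsE) blast
  show ?thesis
  proof (rule embedsI[where p = "\<lambda>e. prod.swap (p (prod.swap e))"])
    fix e assume "e \<in> R\<inverse>"
    then have "p (prod.swap e) \<in> S" using p(1) by (cases e) auto
    then show "prod.swap (p (prod.swap e)) \<in> S\<inverse>" by (cases "p (prod.swap e)") auto
  next
    fix e e' assume "e \<in> R\<inverse>" "e' \<in> R\<inverse>" "fst e < fst e'"
    then show "fst (prod.swap (p (prod.swap e))) < fst (prod.swap (p (prod.swap e')))"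
      using p(3)[of "prod.swap e" "prod.swap e'"] by (cases e; cases e') auto
  next
    fix e e' assume "e \<in> R\<inverse>" "e' \<in> R\<inverse>" "snd e < snd e'"
    then show "snd (prod.swap (p (prod.swap e))) < snd (prod.swap (p (prod.swap e')))"
      using p(2)[of "prod.swap e" "prod.swap e'"] by (cases e; cases e') auto
  qed
qed

lemma is_perm_subset: "is_perm n S \<Longrightarrow> S \<subseteq> {..<n} \<times> {..<n}"
  using bij_betwE[of fst S "{..<n}"] bij_betwE[of snd S "{..<n}"] by (auto simp: is_perm_def)

lemma finite_avoiders [simp]: "finite (avoiders R n)"
  by (rule finite_subset[of _ "Pow ({..<n} \<times> {..<n})"]) (auto simp: avoiders_def)

lemma perm_avoiders_subset: "perm_avoiders R n \<subseteq> avoiders R n"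
  using is_perm_subset by (auto simp: perm_avoiders_def avoiders_def)

lemma finite_perm_avoiders [simp]: "finite (perm_avoiders R n)"
  by (rule finite_subset[OF perm_avoiders_subset]) simp

lemma finite_avoider: "S \<in> avoiders R n \<Longrightarrow> finite S"
  by (auto simp: avoiders_def intro: finite_subset)

lemma card_le_extremal: "S \<in> avoiders R n \<Longrightarrow> card S \<le> extremal R n"
  unfolding extremal_def by (rule Max_ge) auto

lemma empty_avoider:
  assumes "R \<noteq> {}"
  shows "{} \<in> avoiders R n"
  using assms by (auto simp: avoiders_def embeds_def)

lemma extremal_attained:
  assumes "R \<noteq> {}"
  obtains S where "S \<in> avoiders R n" "card S = extremal R n"
proof -
  have "extremal R n \<in> card ` avoiders R n"
    unfolding extremal_def using empty_avoider[OF assms] by (intro Max_in) auto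
  then show ?thesis using that by auto
qed

section \<open>Contraction into square blocks\<close>

lemma div_less_imp_less: "(a::nat) div b < a' div b \<Longrightarrow> a < a'"
  by (meson div_le_mono leD leI)

text \<open>Pick one point of \<open>S\<close> in every block that the embedding hits. Strictly
  ordered quotients come from strictly ordered coordinates, so the picked points form an embedding
  into \<open>S\<close>.\<close>

lemma embeds_contract:
  assumes "embeds R (contract b S)"
  shows "embeds R S"
proof -
  from assms obtain p where p: "\<And>e. e \<in> R \<Longrightarrow> p e \<in> contract b S"
    "\<And>e e'. e \<in> R \<Longrightarrow> e' \<in> R \<Longrightarrow> fst e < fst e' \<Longrightarrow> fst (p e) < fst (p e')"
    "\<And>e e'. e \<in> R \<Longrightarrow> e' \<in> R \<Longrightarrow> snd e < snd e' \<Longrightarrow> snd (p e) < snd (p e')"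
    by (rule embedsE) blast
  have "\<forall>e\<in>R. \<exists>x\<in>S. p e = (fst x div b, snd x div b)"
    using p(1) by (auto simp: contract_def image_iff)
  then obtain q where q: "\<And>e. e \<in> R \<Longrightarrow> q e \<in> S"
    "\<And>e. e \<in> R \<Longrightarrow> p e = (fst (q e) div b, snd (q e) div b)"
    by metis
  show ?thesis
  proof (rule embedsI[where p = q])
    fix e e' assume e: "e \<in> R" "e' \<in> R"
    show "fst (q e) < fst (q e')" if "fst e < fst e'"
      using p(2)[OF e that] q(2)[OF e(1)] q(2)[OF e(2)] by (auto dest: div_less_imp_less)
    show "snd (q e) < snd (q e')" if "snd e < snd e'"
      using p(3)[OF e that] q(2)[OF e(1)] q(2)[OF e(2)] by (auto dest: div_less_imp_less)
  qed (rule q(1))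
qed

lemma contract_avoiders:
  assumes "S \<in> avoiders R (b * n)"
  shows "contract b S \<in> avoiders R n"
proof -
  have "contract b S \<subseteq> {..<n} \<times> {..<n}"
    using assms by (auto simp: contract_def avoiders_def less_mult_imp_div_less mult.commute)
  then show ?thesis using assms embeds_contract by (auto simp: avoiders_def)
qed

definition block :: "nat \<Rightarrow> (nat \<times> nat) set \<Rightarrow> nat \<times> nat \<Rightarrow> (nat \<times> nat) set" where
  "block b S x = {e \<in> S. (fst e div b, snd e div b) = x}"

lemma Union_block: "S = (\<Union>x\<in>contract b S. block b S x)"
  by (force simp: block_def contract_def)

lemma block_subset:
  assumes "0 < b"
  shows "block b S (p, q) \<subseteq> {p * b..<p * b + b} \<times> {q * b..<q * b + b}"
  using assms dividend_less_div_times[of b]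
  by (auto simp: block_def add.commute)

lemma finite_block: "0 < b \<Longrightarrow> finite (block b S x)"
  by (cases x) (auto intro: finite_subset[OF block_subset])

section \<open>Superadditivity\<close>

text \<open>\<open>B\<close> occupies the rows after those of \<open>A\<close>. For \<open>A\<close>
  of size \<open>m\<close> and \<open>B\<close> of size \<open>n\<close>, the offsets
  \<open>u = 0\<close>, \<open>v = m\<close> give the direct sum and \<open>u = n\<close>,
  \<open>v = 0\<close> the skew sum; both are handled at once.\<close>

definition shift_sum :: "nat \<Rightarrow> nat \<Rightarrow> nat \<Rightarrow> (nat \<times> nat) set \<Rightarrow> (nat \<times> nat) set \<Rightarrow> (nat \<times> nat) set" where
  "shift_sum m u v A B = (\<lambda>e. (fst e, snd e + u)) ` A \<union> (\<lambda>e. (fst e + m, snd e + v)) ` B"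

lemma embeds_shift:
  assumes "embeds R ((\<lambda>e. (fst e + m, snd e + v)) ` S)"
  shows "embeds R S"
proof -
  from assms obtain p where p: "\<And>e. e \<in> R \<Longrightarrow> p e \<in> (\<lambda>e. (fst e + m, snd e + v)) ` S"
    "\<And>e e'. e \<in> R \<Longrightarrow> e' \<in> R \<Longrightarrow> fst e < fst e' \<Longrightarrow> fst (p e) < fst (p e')"
    "\<And>e e'. e \<in> R \<Longrightarrow> e' \<in> R \<Longrightarrow> snd e < snd e' \<Longrightarrow> snd (p e) < snd (p e')"
    by (rule embedsE) blast
  have "\<forall>e\<in>R. \<exists>x\<in>S. p e = (fst x + m, snd x + v)"
    using p(1) by (auto simp: image_iff)
  then obtain q where q: "\<And>e. e \<in> R \<Longrightarrow> q e \<in> S"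
    "\<And>e. e \<in> R \<Longrightarrow> p e = (fst (q e) + m, snd (q e) + v)"
    by metis
  show ?thesis
  proof (rule embedsI[where p = q])
    fix e e' assume e: "e \<in> R" "e' \<in> R"
    show "fst (q e) < fst (q e')" if "fst e < fst e'"
      using p(2)[OF e that] q(2)[OF e(1)] q(2)[OF e(2)] by simp
    show "snd (q e) < snd (q e')" if "snd e < snd e'"
      using p(3)[OF e that] q(2)[OF e(1)] q(2)[OF e(2)] by simp
  qed (rule q(1))
qed

text \<open>If R occurs in neither summand, its first row must fall into A and its last row into B; the
  choice of the diagonal or antidiagonal arrangement then puts the columns of these two points in
  the wrong order.\<close>

lemma shift_sum_avoids:
  assumes R: "is_perm k R" and A: "A \<in> avoiders R m" and B: "B \<in> avoiders R n"
    and a: "(0, a) \<in> R" and b: "(k - 1, b) \<in> R"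
    and uv: "b < a \<and> u = 0 \<and> v = m \<or> a < b \<and> u = n \<and> v = 0"
  shows "shift_sum m u v A B \<in> avoiders R (m + n)"
proof -
  have A': "A \<subseteq> {..<m} \<times> {..<m}" "\<not> embeds R A" and B': "B \<subseteq> {..<n} \<times> {..<n}" "\<not> embeds R B"
    using A B by (auto simp: avoiders_def)
  have inj: "inj_on fst R" and sub: "R \<subseteq> {..<k} \<times> {..<k}"
    using R is_perm_subset by (auto simp: is_perm_def bij_betw_def)
  have "\<not> embeds R (shift_sum m u v A B)"
  proof
    assume "embeds R (shift_sum m u v A B)"
    then obtain p where p: "\<And>e. e \<in> R \<Longrightarrow> p e \<in> shift_sum m u v A B"
      "\<And>e e'. e \<in> R \<Longrightarrow> e' \<in> R \<Longrightarrow> fst e < fst e' \<Longrightarrow> fst (p e) < fst (p e')"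
      "\<And>e e'. e \<in> R \<Longrightarrow> e' \<in> R \<Longrightarrow> snd e < snd e' \<Longrightarrow> snd (p e) < snd (p e')"
      by (rule embedsE) blast
    have first: "fst (p (0, a)) \<le> fst (p e)" if "e \<in> R" for e
    proof (cases "fst e = 0")
      case True
      then have "e = (0, a)" using inj_onD[OF inj _ that a] by simp
      then show ?thesis by simp
    next
      case False
      then show ?thesis using p(2)[OF a that] by simp
    qed
    have last: "fst (p e) \<le> fst (p (k - 1, b))" if "e \<in> R" for e
    proof (cases "fst e = k - 1")
      case True
      then have "e = (k - 1, b)" using inj_onD[OF inj _ that b] by simp
      then show ?thesis by simp
    next
      case False
      then have "fst e < k - 1" using sub that by (cases e) force
      then show ?thesis using p(2)[OF that b] by simp
    qed
    \<comment> \<open>By \<open>first\<close>, if the image of the first row lay in the rows of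
      \<open>B\<close>, then so would the whole image, and \<open>R\<close> would embed into
      \<open>B\<close>. The image of the last row is treated symmetrically with
      \<open>A\<close>.\<close>
    have "fst (p (0, a)) < m"
    proof (rule ccontr)
      assume "\<not> fst (p (0, a)) < m"
      then have "p e \<in> (\<lambda>e. (fst e + m, snd e + v)) ` B" if "e \<in> R" for e
        using p(1)[OF that] first[OF that] A'(1) by (auto simp: shift_sum_def)
      then have "embeds R ((\<lambda>e. (fst e + m, snd e + v)) ` B)"
        using p(2,3) by (rule embedsI)
      then show False using B' embeds_shift by blast
    qed
    then have 1: "p (0, a) \<in> (\<lambda>e. (fst e, snd e + u)) ` A"
      using p(1)[OF a] by (auto simp: shift_sum_def)
    have "m \<le> fst (p (k - 1, b))"
    proof (rule ccontr)
      assume "\<not> m \<le> fst (p (k - 1, b))"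
      \<comment> \<open>The summand 0 brings the set into the form required by
        \<open>embeds_shift\<close>, with row shift 0.\<close>
      then have "p e \<in> (\<lambda>e. (fst e + 0, snd e + u)) ` A" if "e \<in> R" for e
        using p(1)[OF that] last[OF that] by (auto simp: shift_sum_def)
      then have "embeds R ((\<lambda>e. (fst e + 0, snd e + u)) ` A)"
        using p(2,3) by (rule embedsI)
      then show False using A' embeds_shift by blast
    qed
    then have 2: "p (k - 1, b) \<in> (\<lambda>e. (fst e + m, snd e + v)) ` B"
      using p(1)[OF b] A'(1) by (auto simp: shift_sum_def)
    from uv show False
    proof
      assume *: "b < a \<and> u = 0 \<and> v = m"
      then have "snd (p (0, a)) < m" "m \<le> snd (p (k - 1, b))" using 1 2 A'(1) by auto
      then show False using p(3)[OF b a] * by simp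
    next
      assume *: "a < b \<and> u = n \<and> v = 0"
      then have "n \<le> snd (p (0, a))" "snd (p (k - 1, b)) < n" using 1 2 B'(1) by auto
      then show False using p(3)[OF a b] * by simp
    qed
  qed
  moreover have "shift_sum m u v A B \<subseteq> {..<m + n} \<times> {..<m + n}"
    using A'(1) B'(1) uv unfolding shift_sum_def by (elim disjE) (auto intro: trans_less_add1)
  ultimately show ?thesis by (simp add: avoiders_def)
qed

lemma card_shift_sum:
  assumes "A \<subseteq> {..<m} \<times> {..<m}" "B \<subseteq> {..<n} \<times> {..<n}"
  shows "card (shift_sum m u v A B) = card A + card B"
proof -
  have "finite A" "finite B" using assms by (auto intro: finite_subset)
  then have "card (shift_sum m u v A B) = card ((\<lambda>e. (fst e, snd e + u)) ` A) + card ((\<lambda>e. (fst e + m, snd e + v)) ` B)"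
    unfolding shift_sum_def using assms by (intro card_Un_disjoint) auto
  also have "\<dots> = card A + card B"
    by (intro arg_cong2[where f = "(+)"] card_image) (auto simp: inj_on_def)
  finally show ?thesis .
qed

text \<open>The rows below \<open>m\<close> return \<open>A\<close> and the remaining rows return
  \<open>B\<close>, each after undoing its shift.\<close>

lemma shift_sum_inj:
  assumes "A \<subseteq> {..<m} \<times> {..<m}" "A' \<subseteq> {..<m} \<times> {..<m}"
    and eq: "shift_sum m u v A B = shift_sum m u v A' B'"
  shows "A = A' \<and> B = B'"
proof -
  have A: "(i, j) \<in> X \<longleftrightarrow> i < m \<and> (i, j + u) \<in> shift_sum m u v X Y"
    if "X \<subseteq> {..<m} \<times> {..<m}" for X Y i j
    using that by (force simp: shift_sum_def)
  have B: "(i, j) \<in> Y \<longleftrightarrow> (i + m, j + v) \<in> shift_sum m u v X Y"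
    if "X \<subseteq> {..<m} \<times> {..<m}" for X Y i j
  proof
    show "(i + m, j + v) \<in> shift_sum m u v X Y" if "(i, j) \<in> Y"
      using rev_image_eqI[OF that, of "(i + m, j + v)" "\<lambda>e. (fst e + m, snd e + v)"]
      by (simp add: shift_sum_def)
    show "(i, j) \<in> Y" if "(i + m, j + v) \<in> shift_sum m u v X Y"
      using that \<open>X \<subseteq> _\<close> unfolding shift_sum_def by auto
  qed
  have "x \<in> A \<longleftrightarrow> x \<in> A'" for x
    using A[OF assms(1), of "fst x" "snd x" B] A[OF assms(2), of "fst x" "snd x" B'] eq by simp
  moreover have "x \<in> B \<longleftrightarrow> x \<in> B'" for x
    using B[OF assms(1), of "fst x" "snd x" B] B[OF assms(2), of "fst x" "snd x" B'] eq by simp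
  ultimately show ?thesis by blast
qed

lemma is_perm_shift_sum:
  assumes "is_perm m A" "is_perm n B" and uv: "u = 0 \<and> v = m \<or> u = n \<and> v = 0"
  shows "is_perm (m + n) (shift_sum m u v A B)"
proof -
  have shift: "bij_betw f (g ` S) {w..<w + l}"
    if "bij_betw f' S {..<l}" "\<And>e. f (g e) = f' e + w" for f f' :: "nat \<times> nat \<Rightarrow> nat" and g S l w
  proof -
    have "f ` g ` S = (\<lambda>i. i + w) ` f' ` S" by (simp add: image_image that(2))
    also have "\<dots> = {w..<w + l}"
      using that(1) by (simp add: bij_betw_def lessThan_atLeast0 add.commute)
    finally have "f ` g ` S = {w..<w + l}" .
    moreover have "inj_on f (g ` S)"
      using that by (auto simp: bij_betw_def inj_on_def)
    ultimately show ?thesis by (simp add: bij_betw_def)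
  qed
  let ?A = "(\<lambda>e. (fst e, snd e + u)) ` A" and ?B = "(\<lambda>e. (fst e + m, snd e + v)) ` B"
  have "bij_betw fst ?A {0..<0 + m}" "bij_betw snd ?A {u..<u + m}"
    "bij_betw fst ?B {m..<m + n}" "bij_betw snd ?B {v..<v + n}"
    using assms(1,2) by (auto simp only: is_perm_def fst_conv snd_conv add_0_right
        intro!: shift[where f' = fst and f = fst] shift[where f' = snd and f = snd])
  then have "bij_betw fst (?A \<union> ?B) ({0..<0 + m} \<union> {m..<m + n})"
    "bij_betw snd (?A \<union> ?B) ({u..<u + m} \<union> {v..<v + n})"
    using uv by (auto intro!: bij_betw_combine)
  moreover have "{0..<0 + m} \<union> {m..<m + n} = {..<m + n}" by auto
  moreover have "{u..<u + m} \<union> {v..<v + n} = {..<m + n}" using uv by auto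
  ultimately show ?thesis by (simp add: is_perm_def shift_sum_def)
qed

lemma is_perm_corners:
  assumes "is_perm k R" "2 \<le> k"
  obtains a b where "(0, a) \<in> R" "(k - 1, b) \<in> R" "a \<noteq> b"
proof -
  have fst: "fst ` R = {..<k}" and snd: "inj_on snd R"
    using assms by (auto simp: is_perm_def bij_betw_def)
  have "0 \<in> fst ` R" "k - 1 \<in> fst ` R" using assms fst by auto
  then obtain a b where ab: "(0, a) \<in> R" "(k - 1, b) \<in> R" by force
  moreover have "a \<noteq> b" using inj_onD[OF snd _ ab] assms by auto
  ultimately show ?thesis using that by blast
qed

text \<open>The arrangement depends only on the order of the columns of the points of
  \<open>R\<close> in its first and last rows. Hence one pair of offsets works for all
  \<open>A\<close> and \<open>B\<close>, which makes the sum an injection when avoiders are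
  counted.\<close>

lemma avoiding_sum_exists:
  assumes "is_perm k R" "2 \<le> k"
  shows "\<exists>u v. (\<forall>A\<in>avoiders R m. \<forall>B\<in>avoiders R n. shift_sum m u v A B \<in> avoiders R (m + n)) \<and>
    (u = 0 \<and> v = m \<or> u = n \<and> v = 0)"
proof -
  from is_perm_corners[OF assms] obtain a b
    where ab: "(0, a) \<in> R" "(k - 1, b) \<in> R" "a \<noteq> b" by blast
  note sum = shift_sum_avoids[OF assms(1) _ _ ab(1,2)]
  show ?thesis
  proof (cases "b < a")
    case True
    then show ?thesis by (intro exI[of _ 0] exI[of _ m]) (use sum in auto)
  next
    case False
    then have "a < b" using ab by simp
    then show ?thesis by (intro exI[of _ n] exI[of _ 0]) (use sum in auto)
  qed
qed

lemma is_perm_nonempty: "is_perm k R \<Longrightarrow> 2 \<le> k \<Longrightarrow> R \<noteq> {}"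
  using is_perm_corners by blast

lemma extremal_superadditive:
  assumes R: "is_perm k R" "2 \<le> k"
  shows "extremal R m + extremal R n \<le> extremal R (m + n)"
proof -
  note ne = is_perm_nonempty[OF R]
  obtain A where A: "A \<in> avoiders R m" "card A = extremal R m" by (rule extremal_attained[OF ne])
  obtain B where B: "B \<in> avoiders R n" "card B = extremal R n" by (rule extremal_attained[OF ne])
  from avoiding_sum_exists[OF R, of m n] obtain u v
    where "\<forall>A\<in>avoiders R m. \<forall>B\<in>avoiders R n. shift_sum m u v A B \<in> avoiders R (m + n)"
    by blast
  then have "card (shift_sum m u v A B) \<le> extremal R (m + n)"
    using A B by (intro card_le_extremal) auto
  then show ?thesis using A B card_shift_sum[of A m B n u v] by (simp add: avoiders_def)
qed

lemma perm_avoiders_supermultiplicative: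
  assumes R: "is_perm k R" "2 \<le> k"
  shows "card (perm_avoiders R m) * card (perm_avoiders R n) \<le> card (perm_avoiders R (m + n))"
proof -
  from avoiding_sum_exists[OF R, of m n] obtain u v
    where sum: "\<forall>A\<in>avoiders R m. \<forall>B\<in>avoiders R n. shift_sum m u v A B \<in> avoiders R (m + n)"
    and uv: "u = 0 \<and> v = m \<or> u = n \<and> v = 0"
    by blast
  have sub: "A \<subseteq> {..<l} \<times> {..<l}" if "A \<in> perm_avoiders R l" for A l
    using that perm_avoiders_subset by (auto simp: avoiders_def)
  have "card (perm_avoiders R m \<times> perm_avoiders R n) \<le> card (perm_avoiders R (m + n))"
  proof (rule card_inj_on_le[where f = "\<lambda>(A, B). shift_sum m u v A B"])
    show "inj_on (\<lambda>(A, B). shift_sum m u v A B) (perm_avoiders R m \<times> perm_avoiders R n)"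
    proof (rule inj_onI, clarify)
      fix A B A' B' assume "A \<in> perm_avoiders R m" "A' \<in> perm_avoiders R m"
        and eq: "shift_sum m u v A B = shift_sum m u v A' B'"
      then show "A = A' \<and> B = B'" by (intro shift_sum_inj[OF sub sub eq])
    qed
    show "(\<lambda>(A, B). shift_sum m u v A B) ` (perm_avoiders R m \<times> perm_avoiders R n) \<subseteq> perm_avoiders R (m + n)"
    proof safe
      fix A B assume AB: "A \<in> perm_avoiders R m" "B \<in> perm_avoiders R n"
      then have "shift_sum m u v A B \<in> avoiders R (m + n)"
        using sum perm_avoiders_subset by blast
      moreover have "is_perm (m + n) (shift_sum m u v A B)"
        using AB uv is_perm_shift_sum by (auto simp: perm_avoiders_def)
      ultimately show "shift_sum m u v A B \<in> perm_avoiders R (m + n)"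
        by (simp add: avoiders_def perm_avoiders_def)
    qed
  qed simp
  then show ?thesis by (simp add: card_cartesian_product)
qed

section \<open>Avoiding permutations exist in every size\<close>

lemma not_embeds_unit:
  assumes "is_perm k R" "2 \<le> k"
  shows "\<not> embeds R {x}"
proof
  assume "embeds R {x}"
  moreover from is_perm_corners[OF assms] obtain a b where "(0, a) \<in> R" "(k - 1, b) \<in> R" "a \<noteq> b"
    by blast
  moreover have "0 < k - 1" using assms(2) by simp
  ultimately show False unfolding embeds_def by (metis fst_conv singletonD less_irrefl)
qed

lemma unit_avoider:
  assumes "is_perm k R" "2 \<le> k"
  shows "{(0, 0)} \<in> perm_avoiders R 1"
  using not_embeds_unit[OF assms] by (auto simp: perm_avoiders_def is_perm_def bij_betw_def)

text \<open>A count of at least 1 has a nonnegative logarithm, as Fekete's lemma requires. Repeated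
  sums with the one-point permutation provide the examples.\<close>

lemma perm_avoiders_nonempty:
  assumes "is_perm k R" "2 \<le> k"
  shows "1 \<le> card (perm_avoiders R n)"
proof (induction n)
  case 0
  have "{} \<in> perm_avoiders R 0"
    using empty_avoider[OF is_perm_nonempty[OF assms]]
    by (auto simp: perm_avoiders_def avoiders_def is_perm_def bij_betw_def)
  then show ?case by (auto simp: Suc_le_eq card_gt_0_iff)
next
  case (Suc n)
  have "1 \<le> card (perm_avoiders R 1)"
    using unit_avoider[OF assms] by (auto simp: Suc_le_eq card_gt_0_iff)
  then have "1 * 1 \<le> card (perm_avoiders R n) * card (perm_avoiders R 1)"
    using Suc by (intro mult_le_mono) auto
  also have "\<dots> \<le> card (perm_avoiders R (n + 1))"
    by (rule perm_avoiders_supermultiplicative[OF assms])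
  finally show ?case by simp
qed

section \<open>Counting by contraction and the Marcus--Tardos bound\<close>

definition cell :: "nat \<Rightarrow> nat \<times> nat \<Rightarrow> (nat \<times> nat) set" where
  "cell b x = {fst x * b..<fst x * b + b} \<times> {snd x * b..<snd x * b + b}"

lemma card_cell: "card (cell b x) = b * b"
  by (simp add: cell_def)

lemma block_subset_cell: "0 < b \<Longrightarrow> block b S x \<subseteq> cell b x"
  using block_subset[of b S "fst x" "snd x"] by (simp add: cell_def)

text \<open>Over a fixed contraction, a point set is determined by the nonempty contents of its occupied
  cells; a 2 x 2 cell has 15 possible contents.\<close>

lemma card_avoiders_double:
  "card (avoiders R (2 * n)) \<le> card (avoiders R n) * 15 ^ extremal R n"
proof -
  define fib where "fib B = {S \<in> avoiders R (2 * n). contract 2 S = B}" for B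
  have fib: "card (fib B) \<le> 15 ^ extremal R n" if B: "B \<in> avoiders R n" for B
  proof -
    have fin: "finite B" using B by (rule finite_avoider)
    let ?T = "\<Pi>\<^sub>E x\<in>B. Pow (cell 2 x) - {{}}"
    have "card (fib B) \<le> card ?T"
    proof (rule card_inj_on_le[where f = "\<lambda>S. restrict (block 2 S) B"])
      show "inj_on (\<lambda>S. restrict (block 2 S) B) (fib B)"
      proof (rule inj_onI)
        fix S S' assume S: "S \<in> fib B" "S' \<in> fib B"
          and eq: "restrict (block 2 S) B = restrict (block 2 S') B"
        have "block 2 S x = block 2 S' x" if "x \<in> B" for x
          using fun_cong[OF eq, of x] that by simp
        then have "(\<Union>x\<in>B. block 2 S x) = (\<Union>x\<in>B. block 2 S' x)" by simp
        then show "S = S'" using Union_block[of S 2] Union_block[of S' 2] S by (simp add: fib_def)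
      qed
      show "(\<lambda>S. restrict (block 2 S) B) ` fib B \<subseteq> ?T"
      proof (intro image_subsetI restrict_PiE_iff[THEN iffD2] ballI)
        fix S x assume "S \<in> fib B" "x \<in> B"
        then have "x \<in> (\<lambda>e. (fst e div 2, snd e div 2)) ` S" by (simp add: fib_def contract_def)
        then obtain e where "e \<in> S" "x = (fst e div 2, snd e div 2)" by blast
        then have "e \<in> block 2 S x" by (simp add: block_def)
        then show "block 2 S x \<in> Pow (cell 2 x) - {{}}" using block_subset_cell[of 2 S x] by auto
      qed
      show "finite ?T" using fin by (auto intro!: finite_PiE simp: cell_def)
    qed
    also have "\<dots> = (\<Prod>x\<in>B. card (Pow (cell 2 x) - {{}}))"
      by (rule card_PiE[OF fin])
    also have "\<dots> = (\<Prod>x\<in>B. 15)"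
    proof (rule prod.cong[OF refl])
      fix x
      have "finite (cell 2 x)" by (simp add: cell_def)
      then show "card (Pow (cell 2 x) - {{}}) = 15"
        by (subst card_Diff_subset) (simp_all add: card_Pow card_cell)
    qed
    also have "\<dots> = 15 ^ card B" by simp
    also have "\<dots> \<le> 15 ^ extremal R n" using card_le_extremal[OF B] by (intro power_increasing) auto
    finally show ?thesis .
  qed
  have "avoiders R (2 * n) \<subseteq> (\<Union>B\<in>avoiders R n. fib B)"
    using contract_avoiders by (auto simp: fib_def)
  then have "card (avoiders R (2 * n)) \<le> card (\<Union>B\<in>avoiders R n. fib B)"
    by (intro card_mono) (auto simp: fib_def)
  also have "\<dots> \<le> (\<Sum>B\<in>avoiders R n. card (fib B))" by (rule card_UN_le) simp
  also have "\<dots> \<le> card (avoiders R n) * 15 ^ extremal R n"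
    using sum_bounded_above[OF fib] by simp
  finally show ?thesis .
qed

text \<open>The Marcus--Tardos argument: k blocks of the same block column that occupy the same set of at
  least k columns contain every k x k permutation matrix.\<close>

lemma card_same_columns:
  assumes R: "is_perm k R" and S: "S \<in> avoiders R (b * n)" and U: "finite U" "k \<le> card U"
  shows "card {p. p < n \<and> snd ` block b S (p, q) = U} \<le> k"
proof (rule ccontr)
  let ?W = "{p. p < n \<and> snd ` block b S (p, q) = U}"
  assume "\<not> card ?W \<le> k"
  then have kW: "k \<le> card ?W" by simp
  obtain h where h: "bij_betw h {..<card ?W} ?W" "strict_mono_on {..<card ?W} h"
    by (rule ex_bij_betw_strict_mono_card[of ?W]) auto
  obtain g where g: "bij_betw g {..<card U} U" "strict_mono_on {..<card U} g"
    by (rule ex_bij_betw_strict_mono_card[OF U(1)])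
  have sub: "fst e < card ?W \<and> snd e < card U" if "e \<in> R" for e
    using is_perm_subset[OF R] that kW U(2) by force
  \<comment> \<open>Every block row in \<open>?W\<close> has a point in each column of
    \<open>U\<close>. The increasing enumerations \<open>h\<close> of block rows and
    \<open>g\<close> of columns therefore realise every position of a \<open>k\<close> by
    \<open>k\<close> pattern.\<close>
  have "\<exists>x\<in>S. fst x div b = h (fst e) \<and> snd x = g (snd e)" if "e \<in> R" for e
  proof -
    have "h (fst e) \<in> ?W" using bij_betwE[OF h(1)] sub[OF that] by blast
    moreover have "g (snd e) \<in> U" using bij_betwE[OF g(1)] sub[OF that] by blast
    ultimately have "g (snd e) \<in> snd ` block b S (h (fst e), q)" by blast
    then show ?thesis unfolding block_def by force
  qed
  then have "\<forall>e\<in>R. \<exists>x\<in>S. fst x div b = h (fst e) \<and> snd x = g (snd e)" by blast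
  then obtain x where x: "\<forall>e\<in>R. x e \<in> S \<and> fst (x e) div b = h (fst e) \<and> snd (x e) = g (snd e)"
    by metis
  have "embeds R S"
  proof (rule embedsI[where p = x])
    fix e assume "e \<in> R" then show "x e \<in> S" using x by blast
  next
    fix e e' assume e: "e \<in> R" "e' \<in> R" "fst e < fst e'"
    then have "h (fst e) < h (fst e')"
      using strict_mono_onD[OF h(2)] sub by blast
    then have "fst (x e) div b < fst (x e') div b" using x e by simp
    then show "fst (x e) < fst (x e')" by (rule div_less_imp_less)
  next
    fix e e' assume e: "e \<in> R" "e' \<in> R" "snd e < snd e'"
    then have "g (snd e) < g (snd e')"
      using strict_mono_onD[OF g(2)] sub by blast
    then show "snd (x e) < snd (x e')" using x e by simp
  qed
  then show False using S by (simp add: avoiders_def)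
qed

text \<open>Each wide block is filed under its block column and the set \<open>U\<close> of columns
  it occupies. There are \<open>n\<close> block columns, at most \<open>2 ^ b\<close> sets in each,
  and at most \<open>k\<close> blocks per set.\<close>

lemma card_wide_blocks:
  assumes R: "is_perm k R" and S: "S \<in> avoiders R (b * n)" and b: "0 < b"
  shows "card {x \<in> {..<n} \<times> {..<n}. k \<le> card (snd ` block b S x)} \<le> n * (2 ^ b * k)"
proof -
  let ?W = "\<lambda>q U. {p. p < n \<and> snd ` block b S (p, q) = U}"
  let ?Q = "\<lambda>q. {q * b..<q * b + b}"
  have sub: "{x \<in> {..<n} \<times> {..<n}. k \<le> card (snd ` block b S x)}
      \<subseteq> (\<Union>q\<in>{..<n}. \<Union>U\<in>{U \<in> Pow (?Q q). k \<le> card U}. (\<lambda>p. (p, q)) ` ?W q U)"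
  proof
    fix x assume x: "x \<in> {x \<in> {..<n} \<times> {..<n}. k \<le> card (snd ` block b S x)}"
    obtain p q where pq: "x = (p, q)" by (cases x)
    have "snd ` block b S (p, q) \<in> {U \<in> Pow (?Q q). k \<le> card U}"
      using block_subset[OF b, of S p q] x pq by auto
    moreover have "x \<in> (\<lambda>p. (p, q)) ` ?W q (snd ` block b S (p, q))" "q \<in> {..<n}"
      using x pq by auto
    ultimately show "x \<in> (\<Union>q\<in>{..<n}. \<Union>U\<in>{U \<in> Pow (?Q q). k \<le> card U}. (\<lambda>p. (p, q)) ` ?W q U)"
      by blast
  qed
  have "card {x \<in> {..<n} \<times> {..<n}. k \<le> card (snd ` block b S x)}
      \<le> card (\<Union>q\<in>{..<n}. \<Union>U\<in>{U \<in> Pow (?Q q). k \<le> card U}. (\<lambda>p. (p, q)) ` ?W q U)"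
    by (rule card_mono[OF _ sub]) auto
  also have "\<dots> \<le> (\<Sum>q<n. card (\<Union>U\<in>{U \<in> Pow (?Q q). k \<le> card U}. (\<lambda>p. (p, q)) ` ?W q U))"
    by (rule card_UN_le) simp
  also have "\<dots> \<le> (\<Sum>q<n. 2 ^ b * k)"
  proof (rule sum_mono)
    fix q
    have "card (\<Union>U\<in>{U \<in> Pow (?Q q). k \<le> card U}. (\<lambda>p. (p, q)) ` ?W q U)
        \<le> (\<Sum>U\<in>{U \<in> Pow (?Q q). k \<le> card U}. card ((\<lambda>p. (p, q)) ` ?W q U))"
      by (rule card_UN_le) simp
    also have "\<dots> \<le> card {U \<in> Pow (?Q q). k \<le> card U} * k"
    proof (rule sum_bounded_above[where K = k, simplified])
      fix U assume "U \<in> {U \<in> Pow (?Q q). k \<le> card U}"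
      then have "card (?W q U) \<le> k"
        by (intro card_same_columns[OF R S]) (auto intro: finite_subset)
      then show "card ((\<lambda>p. (p, q)) ` ?W q U) \<le> k"
        using card_image_le[of "?W q U" "\<lambda>p. (p, q)"] by simp
    qed
    also have "\<dots> \<le> card (Pow (?Q q)) * k"
      by (intro mult_right_mono card_mono) auto
    also have "\<dots> = 2 ^ b * k" by (simp add: card_Pow)
    finally show "card (\<Union>U\<in>{U \<in> Pow (?Q q). k \<le> card U}. (\<lambda>p. (p, q)) ` ?W q U) \<le> 2 ^ b * k" .
  qed
  also have "\<dots> = n * (2 ^ b * k)" by simp
  finally show ?thesis .
qed

lemma is_perm_converse: "is_perm k R \<Longrightarrow> is_perm k (R\<inverse>)"
proof -
  have "bij_betw snd (R\<inverse>) {..<k}" if "bij_betw fst R {..<k}"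
    using that by (fastforce simp: bij_betw_def inj_on_def fst_eq_Domain snd_eq_Range)
  moreover have "bij_betw fst (R\<inverse>) {..<k}" if "bij_betw snd R {..<k}"
    using that by (fastforce simp: bij_betw_def inj_on_def fst_eq_Domain snd_eq_Range)
  ultimately show "is_perm k R \<Longrightarrow> is_perm k (R\<inverse>)" by (simp add: is_perm_def)
qed

text \<open>Transposition preserves avoidance and exchanges tall with wide blocks.\<close>

lemma card_tall_blocks:
  assumes R: "is_perm k R" and S: "S \<in> avoiders R (b * n)" and b: "0 < b"
  shows "card {x \<in> {..<n} \<times> {..<n}. k \<le> card (fst ` block b S x)} \<le> n * (2 ^ b * k)"
proof -
  have "S\<inverse> \<in> avoiders (R\<inverse>) (b * n)"
    using S embeds_converse[of "R\<inverse>" "S\<inverse>"] by (auto simp: avoiders_def)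
  note wide = card_wide_blocks[OF is_perm_converse[OF R] this b]
  have "snd ` block b (S\<inverse>) (prod.swap x) = fst ` block b S x" for x
    by (cases x) (force simp: block_def image_iff)
  then have "{x \<in> {..<n} \<times> {..<n}. k \<le> card (fst ` block b S x)}
     = prod.swap ` {x \<in> {..<n} \<times> {..<n}. k \<le> card (snd ` block b (S\<inverse>) x)}"
    by (auto simp: image_iff)
  then show ?thesis using wide card_image_le[of "{x \<in> {..<n} \<times> {..<n}. k \<le> card (snd ` block b (S\<inverse>) x)}" prod.swap]
    by auto
qed

section \<open>The recurrence for the extremal number and its solution\<close>

lemma extremal_le_square:
  assumes "R \<noteq> {}"
  shows "extremal R n \<le> n * n"
proof -
  obtain S where S: "S \<in> avoiders R n" "card S = extremal R n" by (rule extremal_attained[OF assms])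
  have "card S \<le> card ({..<n} \<times> {..<n})" using S by (intro card_mono) (auto simp: avoiders_def)
  then show ?thesis using S by simp
qed

text \<open>A block that is neither wide nor tall lies in a product of at most \<open>k - 1\<close>
  rows and \<open>k - 1\<close> columns. Any other block is charged its full area.\<close>

lemma card_block_le:
  assumes b: "0 < b"
  shows "card (block b S x) \<le> (k - 1)\<^sup>2 + (if k \<le> card (snd ` block b S x) then b * b else 0)
     + (if k \<le> card (fst ` block b S x) then b * b else 0)"
proof -
  have "finite (cell b x)" by (simp add: cell_def)
  then have 1: "card (block b S x) \<le> b * b"
    using card_mono[OF _ block_subset_cell[OF b, of S x]] by (simp add: card_cell)
  have fin: "finite (block b S x)" by (rule finite_block[OF b])
  have "block b S x \<subseteq> fst ` block b S x \<times> snd ` block b S x" by force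
  then have "card (block b S x) \<le> card (fst ` block b S x \<times> snd ` block b S x)"
    using fin by (intro card_mono) auto
  also have "\<dots> = card (fst ` block b S x) * card (snd ` block b S x)"
    by (rule card_cartesian_product)
  finally have 2: "card (block b S x) \<le> card (fst ` block b S x) * card (snd ` block b S x)" .
  show ?thesis
  proof (cases "k \<le> card (snd ` block b S x) \<or> k \<le> card (fst ` block b S x)")
    case True
    then show ?thesis using 1 by auto
  next
    case False
    then have "card (fst ` block b S x) * card (snd ` block b S x) \<le> (k - 1) * (k - 1)"
      by (intro mult_le_mono) auto
    then show ?thesis using 2 False by (simp add: power2_eq_square)
  qed
qed

text \<open>The contraction avoids \<open>R\<close>, so there are at most
  \<open>extremal R n\<close> occupied blocks to be charged \<open>(k - 1)\<^sup>2\<close> each.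
  Wide and tall blocks are expensive, but their number is linear in \<open>n\<close>.\<close>

lemma extremal_recurrence:
  assumes R: "is_perm k R" "R \<noteq> {}" and b: "0 < b"
  shows "extremal R (b * n) \<le> (k - 1)\<^sup>2 * extremal R n + 2 * (2 ^ b * k) * (b * b) * n"
proof -
  obtain S where S: "S \<in> avoiders R (b * n)" "card S = extremal R (b * n)"
    by (rule extremal_attained[OF R(2)])
  let ?C = "contract b S" and ?N = "{..<n} \<times> {..<n}"
  have C: "?C \<in> avoiders R n" by (rule contract_avoiders[OF S(1)])
  have finC: "finite ?C" by (rule finite_avoider[OF C])
  have sub: "?C \<subseteq> ?N" using C by (simp add: avoiders_def)
  let ?w = "\<lambda>x. k \<le> card (snd ` block b S x)" and ?t = "\<lambda>x. k \<le> card (fst ` block b S x)"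
  have "card S = card (\<Union>x\<in>?C. block b S x)" using Union_block[of S b] by simp
  also have "\<dots> \<le> (\<Sum>x\<in>?C. card (block b S x))" by (rule card_UN_le[OF finC])
  also have "\<dots> \<le> (\<Sum>x\<in>?C. (k - 1)\<^sup>2 + (if ?w x then b * b else 0) + (if ?t x then b * b else 0))"
    by (rule sum_mono) (rule card_block_le[OF b])
  also have "\<dots> = (k - 1)\<^sup>2 * card ?C + (\<Sum>x\<in>?C. if ?w x then b * b else 0) + (\<Sum>x\<in>?C. if ?t x then b * b else 0)"
    by (simp add: sum.distrib)
  also have "\<dots> \<le> (k - 1)\<^sup>2 * extremal R n + n * (2 ^ b * k) * (b * b) + n * (2 ^ b * k) * (b * b)"
  proof (intro add_mono mult_left_mono)
    have le: "(\<Sum>x\<in>?C. if Q x then b * b else 0) \<le> n * (2 ^ b * k) * (b * b)"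
      if "card {x \<in> ?N. Q x} \<le> n * (2 ^ b * k)" for Q
    proof -
      have "(\<Sum>x\<in>?C. if Q x then b * b else 0) \<le> (\<Sum>x\<in>?N. if Q x then b * b else 0)"
        by (rule sum_mono2[OF _ sub]) auto
      also have "\<dots> = card {x \<in> ?N. Q x} * (b * b)"
        by (subst sum.inter_filter[symmetric]) auto
      also have "\<dots> \<le> n * (2 ^ b * k) * (b * b)"
        using that by (intro mult_right_mono) auto
      finally show ?thesis .
    qed
    show "(\<Sum>x\<in>?C. if ?w x then b * b else 0) \<le> n * (2 ^ b * k) * (b * b)"
      by (rule le[OF card_wide_blocks[OF R(1) S(1) b]])
    show "(\<Sum>x\<in>?C. if ?t x then b * b else 0) \<le> n * (2 ^ b * k) * (b * b)"
      by (rule le[OF card_tall_blocks[OF R(1) S(1) b]])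
    show "card ?C \<le> extremal R n" by (rule card_le_extremal[OF C])
  qed simp
  finally show ?thesis using S(2) by (simp add: algebra_simps)
qed

text \<open>With side length \<open>b = k\<^sup>2\<close> the recurrence multiplies by
  \<open>(k - 1)\<^sup>2\<close>, less than the factor \<open>k\<^sup>2\<close> by which the size
  grows, so the solution is linear.\<close>

lemma extremal_power_bound:
  assumes R: "is_perm k R" "R \<noteq> {}" and k: "2 \<le> k"
  obtains E where "\<And>m. extremal R ((k\<^sup>2) ^ m) \<le> E * (k\<^sup>2) ^ m"
proof -
  define D where "D = 2 * (2 ^ k\<^sup>2 * k) * (k\<^sup>2 * k\<^sup>2)"
  \<comment> \<open>This gap absorbs the additive term \<open>D * (k\<^sup>2) ^ m\<close> in the
    induction; the constant \<open>D + 1\<close> also covers size 1.\<close>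
  have kk: "(k - 1)\<^sup>2 + 1 \<le> k\<^sup>2"
  proof -
    obtain l where "k = Suc l" using k by (cases k) auto
    then show ?thesis by (simp add: power2_eq_square)
  qed
  have "extremal R ((k\<^sup>2) ^ m) \<le> (D + 1) * (k\<^sup>2) ^ m" for m
  proof (induction m)
    case 0
    show ?case using extremal_le_square[OF R(2), of 1] by simp
  next
    case (Suc m)
    have "extremal R ((k\<^sup>2) ^ Suc m) \<le> (k - 1)\<^sup>2 * extremal R ((k\<^sup>2) ^ m) + D * (k\<^sup>2) ^ m"
      using extremal_recurrence[OF R, of "k\<^sup>2" "(k\<^sup>2) ^ m"] k by (simp add: D_def)
    also have "\<dots> \<le> (k - 1)\<^sup>2 * ((D + 1) * (k\<^sup>2) ^ m) + (D + 1) * (k\<^sup>2) ^ m"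
      using Suc by (intro add_mono mult_left_mono) auto
    also have "\<dots> = ((k - 1)\<^sup>2 + 1) * ((D + 1) * (k\<^sup>2) ^ m)" by (simp add: algebra_simps)
    also have "\<dots> \<le> k\<^sup>2 * ((D + 1) * (k\<^sup>2) ^ m)" by (rule mult_right_mono[OF kk]) simp
    finally show ?case by (simp add: algebra_simps)
  qed
  then show ?thesis using that by blast
qed

section \<open>Counting avoiding permutations\<close>

definition col_of :: "(nat \<times> nat) set \<Rightarrow> nat \<Rightarrow> nat" where
  "col_of S i = snd (inv_into S fst i)"

definition row_of :: "(nat \<times> nat) set \<Rightarrow> nat \<Rightarrow> nat" where
  "row_of S j = fst (inv_into S snd j)"

lemma col_of_eq:
  assumes "is_perm N S" "(i, j) \<in> S"
  shows "col_of S i = j"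
  using inv_into_f_f[of fst S "(i, j)"] assms by (simp add: is_perm_def bij_betw_def col_of_def)

lemma row_of_eq:
  assumes "is_perm N S" "(i, j) \<in> S"
  shows "row_of S j = i"
  using inv_into_f_f[of snd S "(i, j)"] assms by (simp add: is_perm_def bij_betw_def row_of_def)

lemma row_of_in:
  assumes "is_perm N S" "j < N"
  shows "(row_of S j, j) \<in> S"
proof -
  have "j \<in> snd ` S" using assms by (simp add: is_perm_def bij_betw_def)
  then show ?thesis using row_of_eq[OF assms(1)] by force
qed

lemma col_of_in:
  assumes "is_perm N S" "i < N"
  shows "(i, col_of S i) \<in> S"
proof -
  have "i \<in> fst ` S" using assms by (simp add: is_perm_def bij_betw_def)
  then show ?thesis using col_of_eq[OF assms(1)] by force
qed

lemma is_perm_eqI: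
  assumes "is_perm N S" "is_perm N S'" "\<And>j. j < N \<Longrightarrow> row_of S j = row_of S' j"
  shows "S = S'"
proof -
  have "(i, j) \<in> T \<longleftrightarrow> j < N \<and> i = row_of T j" if "is_perm N T" for T i j
    using row_of_eq[OF that, of i j] row_of_in[OF that, of j] is_perm_subset[OF that] by auto
  then have "(i, j) \<in> S \<longleftrightarrow> (i, j) \<in> S'" for i j using assms by metis
  then show ?thesis by auto
qed

section \<open>Product bounds and the size of a fibre of contraction\<close>

lemma powr_inverse_power:
  fixes x :: real
  assumes "0 \<le> x" "0 < n"
  shows "(x powr (1 / real n)) ^ n = x"
proof (cases "x = 0")
  case False
  then have "(x powr (1 / real n)) ^ n = (x powr (1 / real n)) powr real n"
    using assms by (simp add: powr_realpow)
  then show ?thesis using assms by (simp add: powr_powr)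
qed (use assms in simp)

text \<open>By the inequality of arithmetic and geometric means, the geometric mean of the
  \<open>d p\<close> is at most their average, hence at most \<open>c\<close>.\<close>

lemma prod_le_power_of_sum:
  fixes d :: "nat \<Rightarrow> nat" and c :: real
  assumes "0 < n" "real (\<Sum>p<n. d p) \<le> c * real n"
  shows "real (\<Prod>p<n. d p) \<le> c ^ n"
proof -
  have "(\<Prod>p<n. real (d p)) powr (1 / real (card {..<n})) \<le> (\<Sum>p<n. real (d p) / real (card {..<n}))"
    using assms by (intro arith_geom_mean) (auto simp: lessThan_empty_iff)
  also have "\<dots> \<le> c"
    using assms by (simp add: field_simps flip: sum_divide_distrib)
  finally have "((\<Prod>p<n. real (d p)) powr (1 / real n)) ^ n \<le> c ^ n"
    by (intro power_mono) auto
  moreover have "((\<Prod>p<n. real (d p)) powr (1 / real n)) ^ n = (\<Prod>p<n. real (d p))"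
    by (rule powr_inverse_power) (auto intro: prod_nonneg \<open>0 < n\<close>)
  ultimately show ?thesis by simp
qed

lemma prod_div_group:
  fixes g :: "nat \<Rightarrow> nat"
  assumes "0 < t"
  shows "(\<Prod>i<n * t. g (i div t)) = (\<Prod>p<n. g p) ^ t"
proof -
  have "(\<Prod>i<n * t. g (i div t)) = (\<Prod>p<n. \<Prod>i=p * t..<p * t + t. g (i div t))"
    by (rule prod.nat_group[symmetric])
  also have "\<dots> = (\<Prod>p<n. g p ^ t)"
  proof (rule prod.cong[OF refl])
    fix p
    have "(\<Prod>i=p * t..<p * t + t. g (i div t)) = (\<Prod>i=p * t..<p * t + t. g p)"
    proof (rule prod.cong[OF refl])
      fix i assume "i \<in> {p * t..<p * t + t}"
      then have "i div t = p" using assms by (intro div_nat_eqI) (auto simp: mult.commute)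
      then show "g (i div t) = g p" by simp
    qed
    then show "(\<Prod>i=p * t..<p * t + t. g (i div t)) = g p ^ t" by simp
  qed
  also have "\<dots> = (\<Prod>p<n. g p) ^ t" by (rule prod_power_distrib[symmetric])
  finally show ?thesis .
qed

text \<open>A permutation with contraction B is determined by the block column of each row, a choice inside
  the support of a row of B, and by the order in which the t rows assigned to a block column use its
  columns.\<close>

lemma card_perm_fibre:
  assumes t: "0 < t" and B: "B \<subseteq> {..<n} \<times> {..<n}"
  shows "card {S. is_perm (n * t) S \<and> contract t S = B} \<le> (\<Prod>p<n. card (B `` {p})) ^ t * fact t ^ n"
proof -
  let ?N = "n * t"
  define X where "X f q = {i \<in> {..<?N}. f i = q}" for f :: "nat \<Rightarrow> nat" and q
  \<comment> \<open>Assignments of block columns to rows that respect \<open>B\<close>. Each block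
    column receives exactly \<open>t\<close> rows, since a permutation has one point in each of its
    \<open>t\<close> columns.\<close>
  define Phi where "Phi = {f \<in> (\<Pi>\<^sub>E i\<in>{..<?N}. B `` {i div t}). \<forall>q<n. card (X f q) = t}"
  define \<Psi> where "\<Psi> f = (\<Pi>\<^sub>E q\<in>{..<n}. permutations_of_set (X f q))" for f
  define enc where "enc S = (\<lambda>i\<in>{..<?N}. col_of S i div t,
      \<lambda>q\<in>{..<n}. map (row_of S) [q * t..<q * t + t])" for S
  have finB: "finite B" using B by (auto intro: finite_subset)
  then have finPE: "finite (\<Pi>\<^sub>E i\<in>{..<?N}. B `` {i div t})" by (intro finite_PiE) auto
  then have finPhi: "finite Phi" by (auto simp: Phi_def)
  have fin\<Psi>: "finite (\<Psi> f)" for f unfolding \<Psi>_def by (intro finite_PiE) (auto simp: X_def)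
  have blk: "q * t + t \<le> ?N" if "q < n" for q
    using mult_le_mono1[of "Suc q" n t] that by simp
  have "card {S. is_perm ?N S \<and> contract t S = B} \<le> card (Sigma Phi \<Psi>)"
  proof (rule card_inj_on_le[where f = enc])
    \<comment> \<open>The row lists determine \<open>S\<close>. The first component of
      \<open>enc\<close> confines each list to the orderings of a known set of \<open>t\<close>
      rows, which yields the factor \<open>fact t\<close>.\<close>
    show "inj_on enc {S. is_perm ?N S \<and> contract t S = B}"
    proof (rule inj_onI, clarify)
      fix S S' assume S: "is_perm ?N S" "is_perm ?N S'" and eq: "enc S = enc S'"
      show "S = S'"
      proof (rule is_perm_eqI[OF S])
        fix j assume j: "j < ?N"
        define q where "q = j div t"
        have q: "q < n" using j by (simp add: q_def less_mult_imp_div_less)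
        have "map (row_of S) [q * t..<q * t + t] = map (row_of S') [q * t..<q * t + t]"
          using eq q by (auto simp: enc_def dest!: fun_cong[where x = q])
        moreover have "j \<in> {q * t..<q * t + t}"
          using t dividend_less_div_times[of t j] by (simp add: q_def add.commute)
        ultimately show "row_of S j = row_of S' j" by (simp add: map_eq_conv)
      qed
    qed
    show "enc ` {S. is_perm ?N S \<and> contract t S = B} \<subseteq> Sigma Phi \<Psi>"
    proof (rule image_subsetI, clarify)
      fix S assume S: "is_perm ?N S" and con: "B = contract t S"
      let ?f = "\<lambda>i\<in>{..<?N}. col_of S i div t"
      have f: "?f \<in> (\<Pi>\<^sub>E i\<in>{..<?N}. B `` {i div t})"
        using col_of_in[OF S] by (force simp: con contract_def)
      have perm: "map (row_of S) [q * t..<q * t + t] \<in> permutations_of_set (X ?f q)" if q: "q < n" for q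
      proof (rule permutations_of_setI)
        have "row_of S ` {q * t..<q * t + t} = X ?f q"
        proof (intro equalityI subsetI)
          fix i assume "i \<in> row_of S ` {q * t..<q * t + t}"
          then obtain j where j: "j \<in> {q * t..<q * t + t}" "i = row_of S j" by blast
          then have "(i, j) \<in> S" using row_of_in[OF S, of j] blk[OF q] by simp
          moreover have "j div t = q" using j t by (intro div_nat_eqI) (auto simp: mult.commute)
          ultimately show "i \<in> X ?f q"
            using col_of_eq[OF S] is_perm_subset[OF S] by (auto simp: X_def)
        next
          fix i assume "i \<in> X ?f q"
          then have i: "i < ?N" "col_of S i div t = q" by (auto simp: X_def)
          have "row_of S (col_of S i) = i" by (rule row_of_eq[OF S col_of_in[OF S i(1)]])
          moreover have "col_of S i \<in> {q * t..<q * t + t}"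
            using t dividend_less_div_times[of t "col_of S i"] i(2) by (auto simp: add.commute)
          ultimately show "i \<in> row_of S ` {q * t..<q * t + t}" by (metis imageI)
        qed
        then show "set (map (row_of S) [q * t..<q * t + t]) = X ?f q" by simp
        have "inj_on (row_of S) {q * t..<q * t + t}"
        proof (rule inj_onI)
          fix j j' assume "j \<in> {q * t..<q * t + t}" "j' \<in> {q * t..<q * t + t}" "row_of S j = row_of S j'"
          then show "j = j'"
            using row_of_in[OF S, of j] row_of_in[OF S, of j'] blk[OF q] col_of_eq[OF S]
            by (metis atLeastLessThan_iff less_le_trans)
        qed
        then show "distinct (map (row_of S) [q * t..<q * t + t])" by (simp add: distinct_map)
      qed
      have "card (X ?f q) = t" if "q < n" for q
        using permutations_of_setD[OF perm[OF that]] distinct_card by fastforce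
      then have "?f \<in> Phi" using f by (simp add: Phi_def)
      then show "enc S \<in> Sigma Phi \<Psi>" using perm by (simp add: enc_def \<Psi>_def)
    qed
    show "finite (Sigma Phi \<Psi>)" using finPhi fin\<Psi> by (rule finite_SigmaI)
  qed
  also have "\<dots> = (\<Sum>f\<in>Phi. card (\<Psi> f))" using finPhi fin\<Psi> by (intro card_SigmaI) auto
  also have "\<dots> = (\<Sum>f\<in>Phi. fact t ^ n)"
  proof (rule sum.cong[OF refl])
    fix f assume f: "f \<in> Phi"
    have "card (\<Psi> f) = (\<Prod>q<n. card (permutations_of_set (X f q)))"
      unfolding \<Psi>_def by (rule card_PiE) simp
    also have "\<dots> = (\<Prod>q<n. fact t)"
      using f by (intro prod.cong) (auto simp: Phi_def X_def)
    finally show "card (\<Psi> f) = fact t ^ n" by simp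
  qed
  \<comment> \<open>Dropping the balance condition leaves independent choices; the support of each
    row \<open>p\<close> of \<open>B\<close> is used by the \<open>t\<close> rows with quotient
    \<open>p\<close>.\<close>
  also have "\<dots> \<le> card (\<Pi>\<^sub>E i\<in>{..<?N}. B `` {i div t}) * fact t ^ n"
    using card_mono[OF finPE, of Phi] by (auto simp: Phi_def)
  also have "card (\<Pi>\<^sub>E i\<in>{..<?N}. B `` {i div t}) = (\<Prod>p<n. card (B `` {p})) ^ t"
    by (subst card_PiE) (simp_all add: prod_div_group[OF t, where g = "\<lambda>p. card (B `` {p})"])
  finally show ?thesis .
qed

text \<open>Avoiders are grouped by their contraction \<open>B\<close>. The row sums of
  \<open>B\<close> add up to \<open>card B\<close>, at most \<open>c * n\<close>, so their product
  is at most \<open>c ^ n\<close>; the fibre bound raises this to the power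
  \<open>t\<close>.\<close>

lemma card_perm_avoiders_le:
  fixes c :: real
  assumes t: "0 < t" and n: "0 < n" and c: "real (extremal R n) \<le> c * real n"
  shows "real (card (perm_avoiders R (t * n))) \<le> real (card (avoiders R n)) * (c ^ (t * n) * fact t ^ n)"
proof -
  define fib where "fib B = {S. is_perm (n * t) S \<and> contract t S = B}" for B
  have finfib: "finite (fib B)" for B
    by (rule finite_subset[of _ "Pow ({..<n * t} \<times> {..<n * t})"]) (auto simp: fib_def dest: is_perm_subset)
  have fib: "real (card (fib B)) \<le> c ^ (t * n) * fact t ^ n" if B: "B \<in> avoiders R n" for B
  proof -
    have B': "B \<subseteq> {..<n} \<times> {..<n}" using B by (simp add: avoiders_def)
    have "B = (SIGMA p:{..<n}. B `` {p})" using B' by auto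
    then have "card B = (\<Sum>p<n. card (B `` {p}))"
      using card_SigmaI[of "{..<n}" "\<lambda>p. B `` {p}"] finite_avoider[OF B] by (simp add: finite_Image)
    then have "real (\<Sum>p<n. card (B `` {p})) \<le> c * real n"
      using card_le_extremal[OF B] c by linarith
    then have "real (\<Prod>p<n. card (B `` {p})) ^ t \<le> (c ^ n) ^ t"
      by (intro power_mono prod_le_power_of_sum[OF n]) (auto intro: prod_nonneg)
    also have "\<dots> = c ^ (t * n)" by (simp add: mult.commute flip: power_mult)
    finally have "real (\<Prod>p<n. card (B `` {p})) ^ t * fact t ^ n \<le> c ^ (t * n) * fact t ^ n"
      by (intro mult_right_mono) auto
    moreover have "real (card (fib B)) \<le> real ((\<Prod>p<n. card (B `` {p})) ^ t * fact t ^ n)"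
      unfolding fib_def of_nat_le_iff by (rule card_perm_fibre[OF t B'])
    ultimately show ?thesis unfolding of_nat_mult of_nat_power of_nat_fact by linarith
  qed
  have "perm_avoiders R (t * n) \<subseteq> (\<Union>B\<in>avoiders R n. fib B)"
  proof
    fix S assume S: "S \<in> perm_avoiders R (t * n)"
    then have "contract t S \<in> avoiders R n" using perm_avoiders_subset contract_avoiders by blast
    moreover have "S \<in> fib (contract t S)" using S by (simp add: fib_def perm_avoiders_def mult.commute)
    ultimately show "S \<in> (\<Union>B\<in>avoiders R n. fib B)" by blast
  qed
  then have "card (perm_avoiders R (t * n)) \<le> card (\<Union>B\<in>avoiders R n. fib B)"
    using finfib by (intro card_mono) auto
  also have "\<dots> \<le> (\<Sum>B\<in>avoiders R n. card (fib B))" by (rule card_UN_le) simp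
  finally have "real (card (perm_avoiders R (t * n))) \<le> (\<Sum>B\<in>avoiders R n. real (card (fib B)))"
    by (metis of_nat_le_iff of_nat_sum)
  also have "\<dots> \<le> real (card (avoiders R n)) * (c ^ (t * n) * fact t ^ n)"
    by (rule sum_bounded_above) (rule fib)
  finally show ?thesis .
qed

section \<open>Translation from matrices\<close>

definition ones :: "nat mat \<Rightarrow> (nat \<times> nat) set" where
  "ones A = {(i, j). i < dim_row A \<and> j < dim_col A \<and> A $$ (i, j) = 1}"

lemma num_ones_eq: "num_ones A = card (ones A)"
  by (simp add: num_ones_def ones_def)

lemma ones_zero_one:
  "zero_one_matrix n A \<Longrightarrow> ones A = {(i, j). i < n \<and> j < n \<and> A $$ (i, j) = 1}"
  by (auto simp: zero_one_matrix_def ones_def)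

lemma bij_betw_ones: "bij_betw ones {A. zero_one_matrix n A} (Pow ({..<n} \<times> {..<n}))"
proof (rule bij_betw_imageI)
  show "inj_on ones {A. zero_one_matrix n A}"
  proof (rule inj_onI, clarify)
    fix A B assume A: "zero_one_matrix n A" and B: "zero_one_matrix n B" and eq: "ones A = ones B"
    show "A = B"
    proof (rule eq_matI)
      show "dim_row A = dim_row B" "dim_col A = dim_col B"
        using A B by (auto simp: zero_one_matrix_def)
      fix i j assume "i < dim_row B" "j < dim_col B"
      then have ij: "i < n" "j < n" using B by (auto simp: zero_one_matrix_def)
      then have "A $$ (i, j) \<in> {0, 1}" "B $$ (i, j) \<in> {0, 1}"
        using A B unfolding zero_one_matrix_def by blast+
      moreover have "A $$ (i, j) = 1 \<longleftrightarrow> B $$ (i, j) = 1"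
        using ij eq ones_zero_one[OF A] ones_zero_one[OF B] by auto
      ultimately show "A $$ (i, j) = B $$ (i, j)" by auto
    qed
  qed
  show "ones ` {A. zero_one_matrix n A} = Pow ({..<n} \<times> {..<n})"
  proof (intro equalityI subsetI)
    fix S assume "S \<in> ones ` {A. zero_one_matrix n A}"
    then show "S \<in> Pow ({..<n} \<times> {..<n})" using ones_zero_one by auto
  next
    fix S :: "(nat \<times> nat) set" assume S: "S \<in> Pow ({..<n} \<times> {..<n})"
    let ?A = "mat n n (\<lambda>x. if x \<in> S then 1 else 0) :: nat mat"
    have "zero_one_matrix n ?A" by (simp add: zero_one_matrix_def)
    moreover have "ones ?A = S" using S by (auto simp: ones_def split: if_splits)
    ultimately show "S \<in> ones ` {A. zero_one_matrix n A}" by (metis image_eqI mem_Collect_eq)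
  qed
qed

section \<open>Permutation matrices and containment in terms of point sets\<close>

lemma ex1_iff_bij_betw_fst:
  assumes "R \<subseteq> {..<n} \<times> {..<n}"
  shows "(\<forall>i<n. \<exists>!j. (i, j) \<in> R) \<longleftrightarrow> bij_betw fst R {..<n}"
proof
  assume *: "\<forall>i<n. \<exists>!j. (i, j) \<in> R"
  have "inj_on fst R"
  proof (rule inj_onI)
    fix x y assume xy: "x \<in> R" "y \<in> R" "fst x = fst y"
    then have "fst x < n" using assms by auto
    then show "x = y" using * xy by (metis prod.collapse)
  qed
  moreover have "fst ` R = {..<n}"
  proof -
    have "i \<in> fst ` R" if "i < n" for i using * that by (metis fst_conv image_eqI)
    then show ?thesis using assms by auto
  qed
  ultimately show "bij_betw fst R {..<n}" by (simp add: bij_betw_def)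
next
  assume *: "bij_betw fst R {..<n}"
  show "\<forall>i<n. \<exists>!j. (i, j) \<in> R"
  proof (intro allI impI)
    fix i assume "i < n"
    then have "i \<in> fst ` R" using * by (simp add: bij_betw_def)
    then obtain j where j: "(i, j) \<in> R" by auto
    moreover have "j' = j" if "(i, j') \<in> R" for j'
      using inj_onD[of fst R "(i, j')" "(i, j)"] * that j by (auto simp: bij_betw_def)
    ultimately show "\<exists>!j. (i, j) \<in> R" by blast
  qed
qed

lemma ex1_iff_bij_betw_snd:
  assumes "R \<subseteq> {..<n} \<times> {..<n}"
  shows "(\<forall>j<n. \<exists>!i. (i, j) \<in> R) \<longleftrightarrow> bij_betw snd R {..<n}"
proof
  assume *: "\<forall>j<n. \<exists>!i. (i, j) \<in> R"
  have "inj_on snd R"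
  proof (rule inj_onI)
    fix x y assume xy: "x \<in> R" "y \<in> R" "snd x = snd y"
    then have "snd x < n" using assms by auto
    then show "x = y" using * xy by (metis prod.collapse)
  qed
  moreover have "snd ` R = {..<n}"
  proof -
    have "i \<in> snd ` R" if "i < n" for i using * that by (metis snd_conv image_eqI)
    then show ?thesis using assms by auto
  qed
  ultimately show "bij_betw snd R {..<n}" by (simp add: bij_betw_def)
next
  assume *: "bij_betw snd R {..<n}"
  show "\<forall>j<n. \<exists>!i. (i, j) \<in> R"
  proof (intro allI impI)
    fix j assume "j < n"
    then have "j \<in> snd ` R" using * by (simp add: bij_betw_def)
    then obtain i where i: "(i, j) \<in> R" by auto
    moreover have "i' = i" if "(i', j) \<in> R" for i'
      using inj_onD[of snd R "(i', j)" "(i, j)"] * that i by (auto simp: bij_betw_def)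
    ultimately show "\<exists>!i. (i, j) \<in> R" by blast
  qed
qed

lemma permutation_matrix_iff:
  "permutation_matrix n A \<longleftrightarrow> zero_one_matrix n A \<and> is_perm n (ones A)"
proof (cases "zero_one_matrix n A")
  case True
  have sub: "ones A \<subseteq> {..<n} \<times> {..<n}" using ones_zero_one[OF True] by auto
  have "(\<forall>i<n. \<exists>!j. j < n \<and> A $$ (i, j) = 1) \<longleftrightarrow> (\<forall>i<n. \<exists>!j. (i, j) \<in> ones A)"
    "(\<forall>j<n. \<exists>!i. i < n \<and> A $$ (i, j) = 1) \<longleftrightarrow> (\<forall>j<n. \<exists>!i. (i, j) \<in> ones A)"
    using ones_zero_one[OF True] by auto
  then show ?thesis
    using True ex1_iff_bij_betw_fst[OF sub] ex1_iff_bij_betw_snd[OF sub]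
    by (simp add: permutation_matrix_def is_perm_def)
qed (simp add: permutation_matrix_def)

text \<open>Every row and every column of \<open>P\<close> holds exactly one point. From an
  embedding, the index map \<open>r\<close> is thus read off the images of the points by row and
  \<open>c\<close> by column; for a point \<open>(i, j)\<close> both readings refer to the same
  image.\<close>

lemma contains_matrix_iff:
  assumes P: "permutation_matrix k P"
  shows "contains_matrix A P \<longleftrightarrow> embeds (ones P) (ones A)"
proof -
  have perm: "is_perm k (ones P)" and zo: "zero_one_matrix k P"
    using P by (auto simp: permutation_matrix_iff)
  have dim: "dim_row P = k" "dim_col P = k" using zo by (auto simp: zero_one_matrix_def)
  have sub: "ones P \<subseteq> {..<k} \<times> {..<k}" by (rule is_perm_subset[OF perm])
  have row: "\<forall>i<k. \<exists>!j. (i, j) \<in> ones P" and col: "\<forall>j<k. \<exists>!i. (i, j) \<in> ones P"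
    using ex1_iff_bij_betw_fst[OF sub] ex1_iff_bij_betw_snd[OF sub] perm by (auto simp: is_perm_def)
  show ?thesis
  proof
    assume "contains_matrix A P"
    then obtain r c where r: "strict_mono_on {..<k} r" "r ` {..<k} \<subseteq> {..<dim_row A}"
      and c: "strict_mono_on {..<k} c" "c ` {..<k} \<subseteq> {..<dim_col A}"
      and one: "\<forall>i<k. \<forall>j<k. P $$ (i, j) = 1 \<longrightarrow> A $$ (r i, c j) = 1"
      unfolding contains_matrix_def dim by blast
    show "embeds (ones P) (ones A)"
    proof (rule embedsI[where p = "\<lambda>e. (r (fst e), c (snd e))"])
      fix e assume "e \<in> ones P"
      then show "(r (fst e), c (snd e)) \<in> ones A"
        using r(2) c(2) one by (auto simp: ones_def dim)
    next
      fix e e' assume "e \<in> ones P" "e' \<in> ones P" and lt: "fst e < fst e'"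
      then have "fst e \<in> {..<k}" "fst e' \<in> {..<k}" using sub by auto
      then show "fst (r (fst e), c (snd e)) < fst (r (fst e'), c (snd e'))"
        using strict_mono_onD[OF r(1) _ _ lt] by simp
    next
      fix e e' assume "e \<in> ones P" "e' \<in> ones P" and lt: "snd e < snd e'"
      then have "snd e \<in> {..<k}" "snd e' \<in> {..<k}" using sub by auto
      then show "snd (r (fst e), c (snd e)) < snd (r (fst e'), c (snd e'))"
        using strict_mono_onD[OF c(1) _ _ lt] by simp
    qed
  next
    assume "embeds (ones P) (ones A)"
    then obtain p where p: "\<And>e. e \<in> ones P \<Longrightarrow> p e \<in> ones A"
      "\<And>e e'. e \<in> ones P \<Longrightarrow> e' \<in> ones P \<Longrightarrow> fst e < fst e' \<Longrightarrow> fst (p e) < fst (p e')"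
      "\<And>e e'. e \<in> ones P \<Longrightarrow> e' \<in> ones P \<Longrightarrow> snd e < snd e' \<Longrightarrow> snd (p e) < snd (p e')"
      by (rule embedsE) blast
    from row obtain f where f: "\<And>i. i < k \<Longrightarrow> (i, f i) \<in> ones P" by metis
    from col obtain g where g: "\<And>j. j < k \<Longrightarrow> (g j, j) \<in> ones P" by metis
    let ?r = "\<lambda>i. fst (p (i, f i))" and ?c = "\<lambda>j. snd (p (g j, j))"
    have bounds: "fst (p e) < dim_row A" "snd (p e) < dim_col A" if "e \<in> ones P" for e
      using p(1)[OF that] by (auto simp: ones_def)
    have "strict_mono_on {..<k} ?r" "strict_mono_on {..<k} ?c"
      using p(2,3) f g by (auto intro!: strict_mono_onI)
    moreover have "?r ` {..<k} \<subseteq> {..<dim_row A}" "?c ` {..<k} \<subseteq> {..<dim_col A}"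
      using bounds f g by auto
    moreover have "A $$ (?r i, ?c j) = 1" if "i < k" "j < k" "P $$ (i, j) = 1" for i j
    proof -
      have ij: "(i, j) \<in> ones P" using that by (simp add: ones_def dim)
      then have "f i = j" "g j = i" using row col f[OF that(1)] g[OF that(2)] that by blast+
      then show ?thesis using p(1)[OF ij] by (auto simp: ones_def)
    qed
    ultimately show "contains_matrix A P" unfolding contains_matrix_def dim by blast
  qed
qed

lemma num_avoiding_eq:
  assumes "permutation_matrix k P"
  shows "num_avoiding P n = card (perm_avoiders (ones P) n)"
proof -
  let ?M = "{A. permutation_matrix n A \<and> avoids_matrix A P}"
  have "ones ` ?M = perm_avoiders (ones P) n"
  proof (intro equalityI subsetI)
    fix S assume "S \<in> ones ` ?M"
    then show "S \<in> perm_avoiders (ones P) n"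
      by (auto simp: perm_avoiders_def permutation_matrix_iff contains_matrix_iff[OF assms])
  next
    fix S assume S: "S \<in> perm_avoiders (ones P) n"
    then have "S \<in> Pow ({..<n} \<times> {..<n})" using is_perm_subset by (auto simp: perm_avoiders_def)
    then have "S \<in> ones ` {A. zero_one_matrix n A}"
      unfolding bij_betw_imp_surj_on[OF bij_betw_ones[of n]] .
    then obtain A where "zero_one_matrix n A" "S = ones A" by auto
    then show "S \<in> ones ` ?M" using S
      by (auto simp: perm_avoiders_def permutation_matrix_iff contains_matrix_iff[OF assms])
  qed
  moreover have "inj_on ones ?M"
    by (rule inj_on_subset[OF bij_betw_imp_inj_on[OF bij_betw_ones[of n]]])
      (auto simp: permutation_matrix_iff)
  ultimately show ?thesis unfolding num_avoiding_def by (metis card_image)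
qed

lemma extremal_number_eq:
  assumes "permutation_matrix k P"
  shows "extremal_number n P = extremal (ones P) n"
proof -
  let ?M = "{A. zero_one_matrix n A \<and> avoids_matrix A P}"
  have "ones ` ?M = avoiders (ones P) n"
  proof (intro equalityI subsetI)
    fix S assume "S \<in> ones ` ?M"
    then show "S \<in> avoiders (ones P) n"
      using ones_zero_one by (auto simp: avoiders_def contains_matrix_iff[OF assms])
  next
    fix S assume S: "S \<in> avoiders (ones P) n"
    then have "S \<in> Pow ({..<n} \<times> {..<n})" by (auto simp: avoiders_def)
    then have "S \<in> ones ` {A. zero_one_matrix n A}"
      unfolding bij_betw_imp_surj_on[OF bij_betw_ones[of n]] .
    then obtain A where "zero_one_matrix n A" "S = ones A" by auto
    then show "S \<in> ones ` ?M" using S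
      by (auto simp: avoiders_def contains_matrix_iff[OF assms])
  qed
  moreover have "{num_ones A |A. zero_one_matrix n A \<and> avoids_matrix A P} = card ` ones ` ?M"
    by (auto simp: num_ones_eq image_iff)
  ultimately show ?thesis by (simp add: extremal_number_def extremal_def)
qed

section \<open>Existence of the limits and the bound\<close>

text \<open>Doubling is iterated from size 1, where at most two point sets exist; this is the
  leading factor 2.\<close>

lemma card_avoiders_power:
  fixes c :: real
  assumes bound: "\<And>n. real (extremal R n) \<le> c * real n"
  shows "real (card (avoiders R (2 ^ m))) \<le> 2 * 15 powr (c * 2 ^ m)"
proof -
  have c: "0 \<le> c" using bound[of 1] by simp
  \<comment> \<open>The exponents \<open>c * 2 ^ i\<close> for \<open>i < m\<close> form a geometric
    sum equal to \<open>c * (2 ^ m - 1)\<close>, the sharper form that the induction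
    carries.\<close>
  have "real (card (avoiders R (2 ^ m))) \<le> 2 * 15 powr (c * (2 ^ m - 1))"
  proof (induction m)
    case 0
    have "card (avoiders R 1) \<le> card (Pow {(0::nat, 0::nat)})"
      by (rule card_mono) (auto simp: avoiders_def)
    then show ?case by (simp add: card_Pow)
  next
    case (Suc m)
    have "(15::real) ^ extremal R (2 ^ m) \<le> 15 powr (c * 2 ^ m)"
      using bound[of "2 ^ m"] by (simp flip: powr_realpow)
    then have *: "2 * 15 powr (c * (2 ^ m - 1)) * 15 ^ extremal R (2 ^ m)
        \<le> 2 * 15 powr (c * (2 ^ m - 1)) * 15 powr (c * 2 ^ m)"
      by (rule mult_left_mono) simp
    have "real (card (avoiders R (2 ^ Suc m))) \<le> real (card (avoiders R (2 ^ m)) * 15 ^ extremal R (2 ^ m))"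
      using card_avoiders_double[of R "2 ^ m"] unfolding of_nat_le_iff by simp
    also have "\<dots> \<le> 2 * 15 powr (c * (2 ^ m - 1)) * 15 ^ extremal R (2 ^ m)"
      using Suc by simp
    also note *
    also have "2 * 15 powr (c * (2 ^ m - 1)) * 15 powr (c * 2 ^ m) = 2 * 15 powr (c * (2 ^ Suc m - 1))"
      by (simp add: algebra_simps flip: powr_add)
    finally show ?case .
  qed
  also have "\<dots> \<le> 2 * 15 powr (c * 2 ^ m)"
    using c by (simp add: mult_left_mono)
  finally show ?thesis .
qed

lemma extremal_limit:
  assumes R: "is_perm k R" "2 \<le> k"
  obtains c :: real where "(\<lambda>n. real (extremal R n) / real n) \<longlonglongrightarrow> c"
    "\<And>n. real (extremal R n) \<le> c * real n" "1 \<le> c"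
proof -
  have super: "real (extremal R m) + real (extremal R n) \<le> real (extremal R (m + n))" for m n
    using extremal_superadditive[OF R, of m n] by linarith
  have nonneg: "0 \<le> real (extremal R n)" for n by simp
  obtain E where E: "\<And>m. extremal R ((k\<^sup>2) ^ m) \<le> E * (k\<^sup>2) ^ m"
    using extremal_power_bound[OF R(1) is_perm_nonempty[OF R] R(2)] by blast
  have k2: "2 \<le> k\<^sup>2" using R(2) power_mono[of 2 k 2] by simp
  have pow: "real (extremal R ((k\<^sup>2) ^ m)) \<le> real E * real ((k\<^sup>2) ^ m)" for m
    using E[of m] unfolding of_nat_mult[symmetric] of_nat_le_iff .
  have lin: "real (extremal R n) \<le> 2 * real E * real n" for n
    by (rule superadditive_linear_bound[where u = "\<lambda>n. real (extremal R n)", OF super nonneg k2 pow])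
  obtain c where c: "(\<lambda>n. real (extremal R n) / real n) \<longlonglongrightarrow> c"
    "\<And>n. real (extremal R n) \<le> c * real n"
    using fekete_superadditive[where u = "\<lambda>n. real (extremal R n)", OF super nonneg lin] by blast
  have "1 \<le> extremal R 1"
    using card_le_extremal[of "{(0, 0)}" R 1] unit_avoider[OF R] perm_avoiders_subset by auto
  then have "1 \<le> c" using c(2)[of 1] by simp
  with c show ?thesis using that by blast
qed

text \<open>Logarithms turn supermultiplicativity into superadditivity. Once the limit exists, it
  can be bounded along the sizes \<open>t * 2 ^ m\<close>, the only ones to which iterated doubling
  applies.\<close>

lemma perm_avoiders_limit:
  fixes c :: real
  assumes R: "is_perm k R" "2 \<le> k" and c: "\<And>n. real (extremal R n) \<le> c * real n" "1 \<le> c"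
  obtains L where "(\<lambda>n. ln (real (card (perm_avoiders R n))) / real n) \<longlonglongrightarrow> L"
    and "\<And>t. 1 \<le> t \<Longrightarrow> L \<le> c * ln 15 / real t + ln c + ln (fact t) / real t"
proof -
  define u where "u n = ln (real (card (perm_avoiders R n)))" for n
  have ge1: "1 \<le> real (card (perm_avoiders R n))" for n
    using perm_avoiders_nonempty[OF R, of n] by simp
  have super: "u m + u n \<le> u (m + n)" for m n
  proof -
    have "u m + u n = ln (real (card (perm_avoiders R m) * card (perm_avoiders R n)))"
      using ge1[of m] ge1[of n] by (auto simp: u_def ln_mult)
    also have "\<dots> \<le> u (m + n)"
      unfolding u_def
    proof (rule ln_mono)
      show "0 < real (card (perm_avoiders R m) * card (perm_avoiders R n))"
        using ge1[of m] ge1[of n] by simp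
      show "real (card (perm_avoiders R m) * card (perm_avoiders R n)) \<le> real (card (perm_avoiders R (m + n)))"
        unfolding of_nat_le_iff by (rule perm_avoiders_supermultiplicative[OF R])
    qed
    finally show ?thesis .
  qed
  have nonneg: "0 \<le> u n" for n using ge1[of n] by (simp add: u_def)
  have key: "u (t * 2 ^ m) \<le> ln 2 + c * ln 15 * 2 ^ m + real t * 2 ^ m * ln c + 2 ^ m * ln (fact t)"
    if t: "1 \<le> t" for t m
  proof -
    have "real (card (perm_avoiders R (t * 2 ^ m)))
        \<le> real (card (avoiders R (2 ^ m))) * (c ^ (t * 2 ^ m) * fact t ^ (2 ^ m))"
      by (rule card_perm_avoiders_le[OF _ _ c(1)]) (use t in auto)
    also have "\<dots> \<le> 2 * 15 powr (c * 2 ^ m) * (c ^ (t * 2 ^ m) * fact t ^ (2 ^ m))"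
      using card_avoiders_power[OF c(1), of m] c(2) by (intro mult_right_mono) auto
    finally have "u (t * 2 ^ m) \<le> ln (2 * 15 powr (c * 2 ^ m) * (c ^ (t * 2 ^ m) * fact t ^ (2 ^ m)))"
      unfolding u_def using ge1[of "t * 2 ^ m"] by (intro ln_mono) auto
    also have "\<dots> = ln 2 + c * ln 15 * 2 ^ m + real t * 2 ^ m * ln c + 2 ^ m * ln (fact t)"
      using c(2) by (simp add: ln_mult ln_powr ln_realpow)
    finally show ?thesis .
  qed
  \<comment> \<open>The case \<open>t = 1\<close> gives an exponential bound at powers of 2, enough
    for Fekete's lemma; the sharper bounds for general \<open>t\<close> are used only after the
    limit exists.\<close>
  have pow: "u (2 ^ m) \<le> (ln 2 + c * ln 15 + ln c) * real (2 ^ m)" for m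
  proof -
    have "u (2 ^ m) \<le> ln 2 + (c * ln 15 * 2 ^ m + 2 ^ m * ln c)" using key[of 1 m] by simp
    also have "\<dots> \<le> ln 2 * 2 ^ m + (c * ln 15 * 2 ^ m + 2 ^ m * ln c)" by simp
    finally show ?thesis by (simp add: algebra_simps)
  qed
  have lin: "u n \<le> 2 * (ln 2 + c * ln 15 + ln c) * real n" for n
    by (rule superadditive_linear_bound[where u = u, OF super nonneg order.refl pow])
  obtain L where L: "(\<lambda>n. u n / real n) \<longlonglongrightarrow> L"
    using fekete_superadditive[where u = u, OF super nonneg lin] by blast
  have "L \<le> c * ln 15 / real t + ln c + ln (fact t) / real t" if t: "1 \<le> t" for t
  proof (rule LIMSEQ_le)
    have pow2: "filterlim (\<lambda>m. t * 2 ^ m) at_top sequentially"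
    proof (rule filterlim_at_top_mono[OF filterlim_ident], rule always_eventually, rule allI)
      fix m
      have "m \<le> 2 ^ m" using less_exp[of m] by simp
      also have "\<dots> \<le> t * 2 ^ m" using t by simp
      finally show "m \<le> t * 2 ^ m" .
    qed
    show "(\<lambda>m. u (t * 2 ^ m) / real (t * 2 ^ m)) \<longlonglongrightarrow> L"
      using filterlim_compose[OF L pow2] .
    \<comment> \<open>The constant factor 2 in the count of contractions contributes
      \<open>ln 2 / (t * 2 ^ m)\<close>, which disappears in the limit.\<close>
    have "(\<lambda>m. ln 2 / real t * (1 / 2) ^ m) \<longlonglongrightarrow> 0"
      by (intro tendsto_mult_right_zero LIMSEQ_power_zero) simp
    then show "(\<lambda>m. ln 2 / real t * (1 / 2) ^ m + (c * ln 15 / real t + ln c + ln (fact t) / real t))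
        \<longlonglongrightarrow> c * ln 15 / real t + ln c + ln (fact t) / real t"
      using tendsto_add[OF _ tendsto_const] by fastforce
    show "\<exists>N. \<forall>m\<ge>N. u (t * 2 ^ m) / real (t * 2 ^ m)
        \<le> ln 2 / real t * (1 / 2) ^ m + (c * ln 15 / real t + ln c + ln (fact t) / real t)"
    proof (intro exI[of _ 0] allI impI)
      fix m
      have "u (t * 2 ^ m) / real (t * 2 ^ m)
        \<le> (ln 2 + c * ln 15 * 2 ^ m + real t * 2 ^ m * ln c + 2 ^ m * ln (fact t)) / real (t * 2 ^ m)"
        by (rule divide_right_mono[OF key[OF t]]) simp
      also have "\<dots> = ln 2 / real t * (1 / 2) ^ m + (c * ln 15 / real t + ln c + ln (fact t) / real t)"
        using t by (simp add: field_simps power_divide)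
      finally show "u (t * 2 ^ m) / real (t * 2 ^ m)
        \<le> ln 2 / real t * (1 / 2) ^ m + (c * ln 15 / real t + ln c + ln (fact t) / real t)" .
    qed
  qed
  with L show ?thesis using that[of L] unfolding u_def by blast
qed

lemma stanley_wilf_le:
  assumes P: "permutation_matrix k P" and k: "2 \<le> k"
  shows "stanley_wilf_limit P \<le> F (fueredi_hajnal_limit P) * (fueredi_hajnal_limit P)\<^sup>2"
proof -
  have R: "is_perm k (ones P)" using P by (simp add: permutation_matrix_iff)
  obtain c where c: "(\<lambda>n. real (extremal (ones P) n) / real n) \<longlonglongrightarrow> c"
    "\<And>n. real (extremal (ones P) n) \<le> c * real n" "1 \<le> c"
    using extremal_limit[OF R k] by blast
  have FH: "fueredi_hajnal_limit P = c"
    unfolding fueredi_hajnal_limit_def extremal_number_eq[OF P] by (rule limI[OF c(1)])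
  obtain L where L: "(\<lambda>n. ln (real (card (perm_avoiders (ones P) n))) / real n) \<longlonglongrightarrow> L"
    and le: "\<And>t. 1 \<le> t \<Longrightarrow> L \<le> c * ln 15 / real t + ln c + ln (fact t) / real t"
    using perm_avoiders_limit[OF R k c(2,3)] by blast
  \<comment> \<open>This holds at \<open>n = 0\<close> as well: division by zero gives exponent 0,
    so both sides are 1.\<close>
  have "real (card (perm_avoiders (ones P) n)) powr (1 / real n)
      = exp (ln (real (card (perm_avoiders (ones P) n))) / real n)" for n
    using perm_avoiders_nonempty[OF R k, of n] by (auto simp: powr_def)
  then have "(\<lambda>n. real (num_avoiding P n) powr (1 / real n)) \<longlonglongrightarrow> exp L"
    using tendsto_exp[OF L] by (simp add: num_avoiding_eq[OF P])
  then have SW: "stanley_wilf_limit P = exp L"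
    unfolding stanley_wilf_limit_def by (rule limI)
  \<comment> \<open>The bound \<open>c * fact t powr (1 / t) * 15 powr (c / t)\<close> is
    \<open>c\<^sup>2\<close> times the term of \<open>F\<close> at \<open>t\<close>, because that
    term carries a division by \<open>c\<close>. It holds for every \<open>t\<close>, hence passes
    to the infimum.\<close>
  have "exp L / c\<^sup>2 \<le> F c"
    unfolding F_def
  proof (rule cINF_greatest)
    fix t :: nat assume "t \<in> {1..}"
    then have t: "1 \<le> t" by simp
    have "exp L \<le> exp (c * ln 15 / real t + ln c + ln (fact t) / real t)"
      using le[OF t] by simp
    also have "\<dots> = fact t powr (1 / real t) * 15 powr (c / real t) / c * c\<^sup>2"
      using c(3) by (simp add: exp_add powr_def power2_eq_square)
    finally show "exp L / c\<^sup>2 \<le> fact t powr (1 / real t) * 15 powr (c / real t) / c"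
      using c(3) by (simp add: divide_le_eq)
  qed simp
  then show ?thesis using c(3) by (simp add: FH SW divide_le_eq)
qed

theorem theorem1p1:
  shows "(\<forall>(k::nat) (P::nat mat). k \<ge> 2 \<and> permutation_matrix k P \<longrightarrow>
            stanley_wilf_limit P \<le> F (fueredi_hajnal_limit P) * (fueredi_hajnal_limit P)\<^sup>2)
       \<and> (\<lambda>c. F c - ln 15) \<in> o[at_top](\<lambda>_. 1)"
proof
  show "\<forall>(k::nat) (P::nat mat). k \<ge> 2 \<and> permutation_matrix k P \<longrightarrow>
            stanley_wilf_limit P \<le> F (fueredi_hajnal_limit P) * (fueredi_hajnal_limit P)\<^sup>2"
    using stanley_wilf_le by blast
  show "(\<lambda>c. F c - ln 15) \<in> o[at_top](\<lambda>_. 1)"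
    by (rule smalloI_tendsto) (use tendsto_diff[OF tendsto_F tendsto_const, of "ln 15"] in simp_all)
qed

end
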